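(* Let $L$ be a rootless (positive-definite) even lattice of rank $m$ and let $p$ be an odd prime. Assume that there exist $\lambda+L\in\mathcal{D}(L)=L^*/L$ with $p\lambda\in L$ and a fixed-point free isometry $g\in O(L)$ of order $p$ satisfying the following: (a) $|N(2)|=pm$, where $N=\mathrm{Span}_{\mathbb{Z}}\{\lambda,L\}$; (b) $g(\lambda+L)=\lambda+L$. Then there exists a self-orthogonal code $C$ of length $m/(p-1)$ over $\mathbb{Z}_p$ such that $N\cong L_A(C)$ and $L\cong L_B(C)$. Here $g$ corresponds to $g_{\Delta,e}$ with respect to some $e\in C^\perp$ of Hamming weight $m/(p-1)$ and some base $\Delta$ of the root system $N(2)$.
   Context: $N(2)$ denotes the set of vectors of norm $(\alpha|\alpha)=2$ in $N$; rootless means $L(2)=\emptyset$; $g$ is fixed-point free if it fixes only $0$ in $L$. Constructions A, B. A code of length $t$ over $\mathbb{Z}_p=\mathbb{Z}/p\mathbb{Z}$ is a subgroup $C\subset\mathbb{Z}_p^t$; $C^\perp$ is its dual for $\langle x|y\rangle=\sum x_iy_i$; self-orthogonal means $C\subset C^\perp$; Hamming weight is the number of nonzero coordinates. The root lattice of type $A_{p-1}$ is $A=\{(a_i)\in\mathbb{Z}^p:\sum a_i=0\}$ with base $v_i-v_{i+1}$ ($v_i$ the standard basis), Weyl vector $\rho=\frac12(p-1,p-3,\dots,-p+1)$, fundamental weights $\lambda_j=\frac1p((p-j)\sum_{i\le j}v_i-j\sum_{i>j}v_i)$ ($\lambda_0=0$); $A^*/A\cong\mathbb{Z}_p$ via $\lambda_j+A\leftrightarrow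 j$. For $R=R_1\perp\dots\perp R_t$ ($R_i$ copies of $A$), base $\Delta=\bigcup\Delta_i$ with Weyl vectors $\rho_{\Delta_i}$, canonical map $\nu:R^*\to R^*/R\cong\mathbb{Z}_p^t$ and $\chi_\Delta=\frac1p(\rho_{\Delta_1},\dots,\rho_{\Delta_t})$: $L_A(C)=\nu^{-1}(C)$ and $L_B(C)=\{\alpha\in L_A(C):(\alpha|\chi_\Delta)\in\mathbb{Z}\}$. $g_{\Delta_i}$ is the isometry $(x_1,\dots,x_p)\mapsto(x_p,x_1,\dots,x_{p-1})$ of $R_i$ and $g_{\Delta,e}=(g_{\Delta_1}^{e_1},\dots,g_{\Delta_t}^{e_t})$ for $e\in\mathbb{Z}_p^t$. "Corresponds" means via an isometry $N\cong L_A(C)$ carrying $L$ to $L_B(C)$. *)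

theory Defs
  imports
    "HOL-Analysis.Analysis"
    "HOL-Algebra.Multiplicative_Group"
    "HOL-Algebra.Product_Groups"
begin

section \<open>Lattices in Euclidean space\<close>

definition zspan :: "'a::real_vector set \<Rightarrow> 'a set" where
  "zspan S = module.span (\<lambda>(k::int) x. real_of_int k *\<^sub>R x) S"

text \<open>A positive-definite lattice \<open>L\<close> is realised inside its own ambient space
  \<open>\<real> \<otimes> L\<close>, with the inner product as its form; so lattices are always of full rank.\<close>

definition lattice_of_rank :: "nat \<Rightarrow> 'a::euclidean_space set \<Rightarrow> bool" where
  "lattice_of_rank m L \<longleftrightarrow>
     (\<exists>B. independent B \<and> card B = m \<and> span B = UNIV \<and> L = zspan B)"

text \<open>By polarization an even lattice is integral.\<close>

definition even_lattice :: "'a::euclidean_space set \<Rightarrow> bool" where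
  "even_lattice L \<longleftrightarrow> (\<exists>m. lattice_of_rank m L) \<and> (\<forall>x\<in>L. \<exists>k::int. x \<bullet> x = 2 * real_of_int k)"

definition dual_lattice :: "'a::euclidean_space set \<Rightarrow> 'a set" where
  "dual_lattice L = {x. \<forall>y\<in>L. x \<bullet> y \<in> \<int>}"

definition vectors_of_norm :: "'a::euclidean_space set \<Rightarrow> real \<Rightarrow> 'a set" where
  "vectors_of_norm L n = {x \<in> L. x \<bullet> x = n}"

definition rootless :: "'a::euclidean_space set \<Rightarrow> bool" where
  "rootless L \<longleftrightarrow> vectors_of_norm L 2 = {}"

text \<open>\<open>O(L)\<close>: an isometry of \<open>L\<close> is identified with its unique linear extension to
  \<open>\<real> \<otimes> L\<close>.\<close>

definition isometry_group :: "'a::euclidean_space set \<Rightarrow> ('a \<Rightarrow> 'a) monoid" where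
  "isometry_group L =
     \<lparr>carrier = {g. orthogonal_transformation g \<and> g ` L = L}, monoid.mult = (\<circ>), one = id\<rparr>"

lemma group_isometry_group: "group (isometry_group L)"
proof (rule groupI)
  fix g assume "g \<in> carrier (isometry_group L)"
  then have g: "orthogonal_transformation g" "g ` L = L"
    by (auto simp: isometry_group_def)
  have "inv_into UNIV g ` L = L"
    by (metis g bij_is_inj image_inv_f_f orthogonal_transformation_bij)
  moreover have "inv_into UNIV g \<circ> g = id"
    using g(1) orthogonal_transformation_bij by (metis bij_is_inj inv_o_cancel)
  ultimately show "\<exists>h\<in>carrier (isometry_group L).
      h \<otimes>\<^bsub>isometry_group L\<^esub> g = \<one>\<^bsub>isometry_group L\<^esub>"
    using orthogonal_transformation_inv[OF g(1)]
    by (intro bexI[of _ "inv_into UNIV g"]) (auto simp: isometry_group_def)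
next
  fix g h assume "g \<in> carrier (isometry_group L)" "h \<in> carrier (isometry_group L)"
  then show "g \<otimes>\<^bsub>isometry_group L\<^esub> h \<in> carrier (isometry_group L)"
    by (simp add: isometry_group_def orthogonal_transformation_compose) (metis image_image)
qed (auto simp: isometry_group_def orthogonal_transformation_def comp_assoc linear_id)

definition fixed_point_free_on :: "'a::euclidean_space set \<Rightarrow> ('a \<Rightarrow> 'a) \<Rightarrow> bool" where
  "fixed_point_free_on L g \<longleftrightarrow> (\<forall>x\<in>L. g x = x \<longrightarrow> x = 0)"

definition root_base :: "'a::euclidean_space set \<Rightarrow> 'a set \<Rightarrow> bool" where
  "root_base \<Phi> \<Delta> \<longleftrightarrow> \<Delta> \<subseteq> \<Phi> \<and> independent \<Delta> \<and>
     (\<forall>\<alpha>\<in>\<Phi>. \<exists>c :: 'a \<Rightarrow> nat. \<alpha> = (\<Sum>\<delta>\<in>\<Delta>. real (c \<delta>) *\<^sub>R \<delta>) \<or> \<alpha> = - (\<Sum>\<delta>\<in>\<Delta>. real (c \<delta>) *\<^sub>R \<delta>))"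


section \<open>Codes over \<open>\<int>/p\<int>\<close>\<close>

definition word_group :: "nat \<Rightarrow> nat \<Rightarrow> (nat \<Rightarrow> int) monoid" where
  "word_group p t = product_group {..<t} (\<lambda>_. integer_mod_group p)"

definition is_code :: "nat \<Rightarrow> nat \<Rightarrow> (nat \<Rightarrow> int) set \<Rightarrow> bool" where
  "is_code p t C \<longleftrightarrow> subgroup C (word_group p t)"

definition dual_code :: "nat \<Rightarrow> nat \<Rightarrow> (nat \<Rightarrow> int) set \<Rightarrow> (nat \<Rightarrow> int) set" where
  "dual_code p t C =
     {x \<in> carrier (word_group p t). \<forall>y\<in>C. (\<Sum>i<t. x i * y i) mod int p = 0}"

definition self_orthogonal :: "nat \<Rightarrow> nat \<Rightarrow> (nat \<Rightarrow> int) set \<Rightarrow> bool" where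
  "self_orthogonal p t C \<longleftrightarrow> C \<subseteq> dual_code p t C"

definition hamming_weight :: "nat \<Rightarrow> (nat \<Rightarrow> int) \<Rightarrow> nat" where
  "hamming_weight t x = card {i \<in> {..<t}. x i \<noteq> 0}"


section \<open>Constructions A and B\<close>

text \<open>Vectors of \<open>\<real> \<otimes> A\<^bsub>p-1\<^esub>\<^sup>t\<close> are doubly indexed families \<open>x i j\<close>, where \<open>i < t\<close> is the
  component and \<open>j < p\<close> the coordinate inside it, extended by \<open>0\<close>. Coordinates are counted
  from \<open>0\<close>, so \<open>x i j\<close> is the coefficient of \<open>v\<^bsub>j+1\<^esub>\<close> in the component \<open>R\<^bsub>i+1\<^esub>\<close>.\<close>

type_synonym bvec = "nat \<Rightarrow> nat \<Rightarrow> real"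

definition ambient :: "nat \<Rightarrow> nat \<Rightarrow> bvec set" where
  "ambient p t = {x. (\<forall>i j. i \<ge> t \<or> j \<ge> p \<longrightarrow> x i j = 0) \<and> (\<forall>i<t. (\<Sum>j<p. x i j) = 0)}"

definition bform :: "nat \<Rightarrow> nat \<Rightarrow> bvec \<Rightarrow> bvec \<Rightarrow> real" where
  "bform p t x y = (\<Sum>i<t. \<Sum>j<p. x i j * y i j)"

definition root_lattice :: "nat \<Rightarrow> nat \<Rightarrow> bvec set" where
  "root_lattice p t = {x \<in> ambient p t. \<forall>i j. x i j \<in> \<int>}"

definition dual_root_lattice :: "nat \<Rightarrow> nat \<Rightarrow> bvec set" where
  "dual_root_lattice p t = {x \<in> ambient p t. \<forall>y\<in>root_lattice p t. bform p t x y \<in> \<int>}"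

text \<open>The simple root \<open>v\<^bsub>j+1\<^esub> - v\<^bsub>j+2\<^esub>\<close> of the component \<open>i\<close>.\<close>

definition simple_root :: "nat \<Rightarrow> nat \<Rightarrow> bvec" where
  "simple_root i j = (\<lambda>i' j'. if i' = i \<and> j' = j then 1 else if i' = i \<and> j' = Suc j then -1 else 0)"

definition standard_base :: "nat \<Rightarrow> nat \<Rightarrow> bvec set" where
  "standard_base p t = {simple_root i j | i j. i < t \<and> Suc j < p}"

text \<open>The fundamental weight \<open>\<lambda>\<^sub>k\<close> of a single component.\<close>

definition fund_weight :: "nat \<Rightarrow> nat \<Rightarrow> nat \<Rightarrow> real" where
  "fund_weight p k j =
     (if j < k then (real p - real k) / real p else if j < p then - real k / real p else 0)"

definition weight_of_word :: "nat \<Rightarrow> nat \<Rightarrow> (nat \<Rightarrow> int) \<Rightarrow> bvec" where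
  "weight_of_word p t c = (\<lambda>i j. if i < t then fund_weight p (nat (c i)) j else 0)"

text \<open>The canonical map \<open>R\<^sup>* \<rightarrow> R\<^sup>*/R \<cong> (\<int>/p\<int>)\<^sup>t\<close>.\<close>

definition nu :: "nat \<Rightarrow> nat \<Rightarrow> bvec \<Rightarrow> nat \<Rightarrow> int" where
  "nu p t x = (THE c. c \<in> carrier (word_group p t) \<and>
                     (\<lambda>i j. x i j - weight_of_word p t c i j) \<in> root_lattice p t)"

definition constr_A :: "nat \<Rightarrow> nat \<Rightarrow> (nat \<Rightarrow> int) set \<Rightarrow> bvec set" where
  "constr_A p t C = {x \<in> dual_root_lattice p t. nu p t x \<in> C}"

text \<open>\<open>weyl_chi\<close> is \<open>\<chi>\<^bsub>\<Delta>\<^esub> = (\<rho>, \<dots>, \<rho>) / p\<close> with \<open>\<rho> = (p-1, p-3, \<dots>, -p+1) / 2\<close>.\<close>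

definition weyl_chi :: "nat \<Rightarrow> nat \<Rightarrow> bvec" where
  "weyl_chi p t =
     (\<lambda>i j. if i < t \<and> j < p then (1 / real p) * ((real p - 1 - 2 * real j) / 2) else 0)"

definition constr_B :: "nat \<Rightarrow> nat \<Rightarrow> (nat \<Rightarrow> int) set \<Rightarrow> bvec set" where
  "constr_B p t C = {x \<in> constr_A p t C. bform p t x (weyl_chi p t) \<in> \<int>}"

text \<open>The isometry \<open>(x\<^sub>1, \<dots>, x\<^sub>p) \<mapsto> (x\<^sub>p, x\<^sub>1, \<dots>, x\<^bsub>p-1\<^esub>)\<close> of one component.\<close>

definition cyc :: "nat \<Rightarrow> (nat \<Rightarrow> real) \<Rightarrow> nat \<Rightarrow> real" where
  "cyc p a = (\<lambda>j. if j \<ge> p then 0 else if j = 0 then a (p - 1) else a (j - 1))"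

definition g_std :: "nat \<Rightarrow> nat \<Rightarrow> (nat \<Rightarrow> int) \<Rightarrow> bvec \<Rightarrow> bvec" where
  "g_std p t e x = (\<lambda>i. if i < t then (cyc p ^^ nat (e i)) (x i) else (\<lambda>_. 0))"

definition is_isometry_onto ::
    "nat \<Rightarrow> nat \<Rightarrow> 'a::euclidean_space set \<Rightarrow> bvec set \<Rightarrow> ('a \<Rightarrow> bvec) \<Rightarrow> bool" where
  "is_isometry_onto p t N M f \<longleftrightarrow> bij_betw f N M \<and>
     (\<forall>x\<in>N. \<forall>y\<in>N. f (x + y) = (\<lambda>i j. f x i j + f y i j)) \<and>
     (\<forall>x\<in>N. \<forall>y\<in>N. bform p t (f x) (f y) = x \<bullet> y)"

end

theory Submission
  imports Defs "HOL-Number_Theory.Cong"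
begin

text \<open>Since \<open>g\<close> fixes \<open>\<lambda> + L\<close>, \<open>g - 1\<close> maps \<open>N\<close> into the rootless lattice \<open>L\<close>. Hence two distinct roots
  of \<open>N\<close> in one coset of \<open>L\<close> have a nonpositive inner product, and as every \<open>g\<close>-orbit sums to \<open>0\<close>, an orbit
  of roots is a cycle, the affine diagram of type \<open>A\<^bsub>p-1\<^esub>\<close>, and distinct orbits in one coset are
  orthogonal. So a coset contains at most \<open>m/(p-1)\<close> orbits, and \<open>|N(2)| = pm\<close> forces equality: the roots in
  \<open>\<lambda> + L\<close> form \<open>t = m/(p-1)\<close> orthogonal cycles, which span a root lattice \<open>R \<subseteq> N\<close> of type \<open>A\<^bsub>p-1\<^esub>\<^sup>t\<close> and of
  full rank. Since \<open>R \<subseteq> N \<subseteq> R\<^sup>*\<close>, \<open>N\<close> is \<open>L\<^sub>A(C)\<close> for the code \<open>C = \<nu>(N)\<close>.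

  The quotient \<open>N/L \<cong> \<int>/p\<close> is the pairing modulo \<open>\<int>\<close> with a vector \<open>c \<in> L\<^sup>*\<close> that has value \<open>1/p\<close> on every root
  of these cycles. As a root of each cycle can be chosen freely to start the base, one can achieve
  \<open>c - \<chi>\<^bsub>\<Delta>\<^esub> \<in> R\<close>; then \<open>c\<close> and \<open>\<chi>\<^bsub>\<Delta>\<^esub>\<close> have the same pairings with \<open>N\<close> modulo \<open>\<int>\<close>, and \<open>L\<close> is \<open>L\<^sub>B(C)\<close>.\<close>

section \<open>Words and the dual root lattice\<close>

lemma carrier_word_group:
  assumes "0 < p"
  shows "carrier (word_group p t) = PiE {..<t} (\<lambda>_. {0..<int p})"
  using assms by (simp add: word_group_def carrier_integer_mod_group)

lemma sum_fund_weight: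
  assumes "k \<le> p" "0 < p"
  shows "(\<Sum>j<p. fund_weight p k j) = 0"
proof -
  have "(\<Sum>j<p. fund_weight p k j) = (\<Sum>j<p. (if j < k then 1 else 0) - real k / real p)"
    using assms by (intro sum.cong) (auto simp: fund_weight_def field_simps)
  also have "\<dots> = (\<Sum>j<p. if j < k then 1 else 0) - real k"
    using assms by (simp add: sum_subtractf)
  also have "(\<Sum>j<p. if j < k then 1 else 0::real) = real k"
  proof -
    have "{..<p} \<inter> {j. j < k} = {..<k}" using assms by auto
    then show ?thesis by (simp add: sum.If_cases)
  qed
  finally show ?thesis by simp
qed

lemma fund_weight_plus_Ints:
  assumes "j < p" "0 < p"
  shows "fund_weight p k j + real k / real p \<in> \<int>"
  using assms by (auto simp: fund_weight_def field_simps)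

lemma weight_of_word_ambient:
  assumes "0 < p" "c \<in> carrier (word_group p t)"
  shows "weight_of_word p t c \<in> ambient p t"
proof -
  have *: "nat (c i) \<le> p" if "i < t" for i
    using assms that by (auto simp: carrier_word_group PiE_iff nat_le_iff less_imp_le)
  have "fund_weight p (nat (c i)) j = 0" if "i < t" "p \<le> j" for i j
    using *[OF that(1)] that(2) by (simp add: fund_weight_def)
  then show ?thesis
    using assms(1) * by (simp add: ambient_def weight_of_word_def sum_fund_weight)
qed

lemma root_latticeI:
  assumes "x \<in> ambient p t" "\<And>i j. i < t \<Longrightarrow> j < p \<Longrightarrow> x i j \<in> \<int>"
  shows "x \<in> root_lattice p t"
proof -
  have "x i j \<in> \<int>" for i j
    using assms by (cases "i < t \<and> j < p") (auto simp: ambient_def)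
  then show ?thesis using assms(1) by (simp add: root_lattice_def)
qed

lemma simple_root_in_root_lattice:
  assumes "i < t" "Suc j < p"
  shows "simple_root i j \<in> root_lattice p t"
proof -
  have "(\<Sum>j'<p. simple_root i j i' j') = 0" for i'
  proof (cases "i' = i")
    case True
    have "(\<Sum>j'<p. simple_root i j i' j')
      = (\<Sum>j'<p. (if j' = j then 1 else 0) - (if j' = Suc j then 1 else 0))"
      using True by (intro sum.cong) (auto simp: simple_root_def)
    also have "\<dots> = 0" using assms by (simp add: sum_subtractf)
    finally show ?thesis .
  qed (simp add: simple_root_def)
  then show ?thesis
    using assms by (auto simp: root_lattice_def ambient_def simple_root_def)
qed

lemma bform_simple_root:
  assumes "i < t" "Suc j < p"
  shows "bform p t x (simple_root i j) = x i j - x i (Suc j)"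
proof -
  have "bform p t x (simple_root i j)
    = (\<Sum>i'<t. if i' = i then (\<Sum>j'<p. x i j' * simple_root i j i j') else 0)"
    unfolding bform_def by (intro sum.cong) (auto simp: simple_root_def)
  also have "\<dots> = (\<Sum>j'<p. x i j' * simple_root i j i j')"
    using assms by simp
  also have "\<dots> = (\<Sum>j'<p. (if j' = j then x i j' else 0) - (if j' = Suc j then x i j' else 0))"
    by (intro sum.cong) (auto simp: simple_root_def)
  also have "\<dots> = x i j - x i (Suc j)"
    using assms by (simp add: sum_subtractf)
  finally show ?thesis .
qed

lemma Ints_diff_of_steps:
  fixes a :: "nat \<Rightarrow> real"
  assumes step: "\<And>j. Suc j < p \<Longrightarrow> a j - a (Suc j) \<in> \<int>" and jk: "j < p" "k < p"
  shows "a j - a k \<in> \<int>"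
proof -
  have base: "a 0 - a j \<in> \<int>" if "j < p" for j
    using that
  proof (induction j)
    case (Suc j)
    have "a 0 - a (Suc j) = (a 0 - a j) + (a j - a (Suc j))" by simp
    then show ?case using Suc step[of j] by (metis Ints_add Suc_lessD)
  qed simp
  have "a j - a k = (a 0 - a k) - (a 0 - a j)" by simp
  then show ?thesis using base jk by (metis Ints_diff)
qed

text \<open>Pairing with a simple root gives the difference of two neighbouring coordinates, and
  these differences add up along a component.\<close>

lemma dual_root_lattice_diff_Ints:
  assumes "y \<in> dual_root_lattice p t" "i < t" "j < p" "k < p"
  shows "y i j - y i k \<in> \<int>"
proof (rule Ints_diff_of_steps[OF _ assms(3,4)])
  fix j assume "Suc j < p"
  then show "y i j - y i (Suc j) \<in> \<int>"
    using assms bform_simple_root[of i t j p y] simple_root_in_root_lattice[of i t j p]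
    by (auto simp: dual_root_lattice_def)
qed

text \<open>The word of \<open>y\<close> can be read off its last coordinates, since the last coordinate of
  \<open>\<lambda>\<^sub>k\<close> is \<open>-k/p\<close>.\<close>

lemma nu_characterization:
  assumes p: "0 < p" and y: "y \<in> dual_root_lattice p t" and c: "c \<in> carrier (word_group p t)"
  shows "(\<lambda>i j. y i j - weight_of_word p t c i j) \<in> root_lattice p t
    \<longleftrightarrow> (\<forall>i<t. y i (p - 1) + real_of_int (c i) / real p \<in> \<int>)"
proof -
  let ?z = "\<lambda>i j. y i j - weight_of_word p t c i j"
  have c_range: "0 \<le> c i" "c i < int p" if "i < t" for i
    using c that p by (auto simp: carrier_word_group PiE_iff)
  have amb: "?z \<in> ambient p t"
    using y weight_of_word_ambient[OF p c] by (auto simp: dual_root_lattice_def ambient_def sum_subtractf)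
  have "?z i j \<in> \<int> \<longleftrightarrow> y i (p - 1) + real_of_int (c i) / real p \<in> \<int>" if "i < t" "j < p" for i j
  proof -
    have 1: "y i j - y i (p - 1) \<in> \<int>"
      using dual_root_lattice_diff_Ints[OF y that(1) that(2), of "p - 1"] p by simp
    have 2: "fund_weight p (nat (c i)) j + real_of_int (c i) / real p \<in> \<int>"
      using fund_weight_plus_Ints[OF that(2) p, of "nat (c i)"] c_range[OF that(1)] by simp
    have "?z i j - (y i (p - 1) + real_of_int (c i) / real p)
      = (y i j - y i (p - 1)) - (fund_weight p (nat (c i)) j + real_of_int (c i) / real p)"
      using that by (simp add: weight_of_word_def)
    then have "?z i j - (y i (p - 1) + real_of_int (c i) / real p) \<in> \<int>"
      using 1 2 by (metis Ints_diff)
    then show ?thesis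
      by (metis Ints_add Ints_diff add_diff_cancel_left' diff_add_cancel)
  qed
  then have "(\<forall>i<t. \<forall>j<p. ?z i j \<in> \<int>) \<longleftrightarrow> (\<forall>i<t. y i (p - 1) + real_of_int (c i) / real p \<in> \<int>)"
    using p by metis
  moreover have "(\<forall>i j. ?z i j \<in> \<int>) \<longleftrightarrow> (\<forall>i<t. \<forall>j<p. ?z i j \<in> \<int>)"
    using amb by (metis (mono_tags, lifting) Ints_0 ambient_def leI mem_Collect_eq)
  ultimately show ?thesis
    using amb by (simp add: root_lattice_def)
qed

text \<open>Behind the uniqueness needed for the description in \<open>nu\<close>: a residue has
  only one representative between 0 and p - 1.\<close>

lemma int_eq_if_quotient_diff_Ints:
  fixes a b :: int
  assumes "0 < p" "0 \<le> a" "a < int p" "0 \<le> b" "b < int p"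
    and "(real_of_int a - real_of_int b) / real p \<in> \<int>"
  shows "a = b"
proof -
  obtain k where "(real_of_int a - real_of_int b) / real p = real_of_int k"
    using assms(6) by (auto elim: Ints_cases)
  then have "real_of_int (a - b) = real_of_int (k * int p)"
    using assms(1) by (simp add: field_simps)
  then have "a - b = k * int p" by (simp only: of_int_eq_iff)
  then have "int p dvd a - b" by simp
  then show ?thesis
    using assms by (metis mod_eq_dvd_iff mod_pos_pos_trivial)
qed

lemma nu_eqI:
  assumes p: "0 < p" and y: "y \<in> dual_root_lattice p t" and c: "c \<in> carrier (word_group p t)"
    and int: "\<And>i. i < t \<Longrightarrow> y i (p - 1) + real_of_int (c i) / real p \<in> \<int>"
  shows "nu p t y = c"
  unfolding nu_def
proof (rule the_equality)
  show "c \<in> carrier (word_group p t) \<and> (\<lambda>i j. y i j - weight_of_word p t c i j) \<in> root_lattice p t"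
    using nu_characterization[OF p y c] c int by simp
next
  fix d assume d: "d \<in> carrier (word_group p t) \<and> (\<lambda>i j. y i j - weight_of_word p t d i j) \<in> root_lattice p t"
  have *: "d i = c i" if "i < t" for i
  proof (rule int_eq_if_quotient_diff_Ints[OF p])
    have "y i (p - 1) + real_of_int (d i) / real p \<in> \<int>"
      using nu_characterization[OF p y, of d] d that by simp
    then have "(y i (p - 1) + real_of_int (d i) / real p) - (y i (p - 1) + real_of_int (c i) / real p) \<in> \<int>"
      using int[OF that] by (rule Ints_diff)
    then show "(real_of_int (d i) - real_of_int (c i)) / real p \<in> \<int>"
      by (simp add: diff_divide_distrib)
  qed (use c d that p in \<open>auto simp: carrier_word_group PiE_iff\<close>)
  show "d = c"
    by (rule PiE_ext[of _ "{..<t}" "\<lambda>_. {0..<int p}"]) (use c d p * in \<open>auto simp: carrier_word_group\<close>)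
qed

text \<open>The coordinates of a component sum to 0, so p times one of them is a sum of coordinate
  differences.\<close>

lemma dual_root_lattice_scaled_Ints:
  assumes y: "y \<in> dual_root_lattice p t" and ij: "i < t" "j < p"
  shows "real p * y i j \<in> \<int>"
proof -
  have "real p * y i j = (\<Sum>k<p. y i j - y i k)"
    using y ij by (simp add: sum_subtractf dual_root_lattice_def ambient_def)
  also have "\<dots> \<in> \<int>"
    using dual_root_lattice_diff_Ints[OF y] ij by (intro Ints_sum) auto
  finally show ?thesis .
qed

lemma nu_carrier_and_Ints:
  assumes p: "0 < p" and y: "y \<in> dual_root_lattice p t"
  shows "nu p t y \<in> carrier (word_group p t)"
    and "\<And>i j. i < t \<Longrightarrow> j < p \<Longrightarrow> y i j + real_of_int (nu p t y i) / real p \<in> \<int>"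
proof -
  \<comment> \<open>\<open>p * y i (p - 1)\<close> is an integer, so the floor only converts the
    type; the sign is that of the last coordinate \<open>-k/p\<close> of
    \<open>\<lambda>\<^sub>k\<close>.\<close>
  define c where "c = (\<lambda>i\<in>{..<t}. \<lfloor>- real p * y i (p - 1)\<rfloor> mod int p)"
  have c: "c \<in> carrier (word_group p t)"
    using p by (auto simp: carrier_word_group c_def)
  have int: "y i (p - 1) + real_of_int (c i) / real p \<in> \<int>" if "i < t" for i
  proof -
    have "real p * y i (p - 1) \<in> \<int>"
      using dual_root_lattice_scaled_Ints[OF y that, of "p - 1"] p by simp
    then obtain n where n: "real p * y i (p - 1) = real_of_int n"
      by (auto elim: Ints_cases)
    have "\<lfloor>- real p * y i (p - 1)\<rfloor> = - n"
      using n by (simp flip: of_int_minus)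
    then have ci: "c i = - n mod int p"
      using that by (simp add: c_def)
    have "- n = int p * (- n div int p) + c i"
      using ci by simp
    then have "real_of_int (- n) = real_of_int (int p * (- n div int p) + c i)"
      by (rule arg_cong)
    then have "real p * y i (p - 1) + real_of_int (c i) = - real p * real_of_int (- n div int p)"
      unfolding n by simp
    then have "y i (p - 1) + real_of_int (c i) / real p = - real_of_int (- n div int p)"
      using p by (simp add: field_simps)
    then show ?thesis by simp
  qed
  have nu: "nu p t y = c" by (rule nu_eqI[OF p y c int])
  then show "nu p t y \<in> carrier (word_group p t)" using c by simp
  show "y i j + real_of_int (nu p t y i) / real p \<in> \<int>" if "i < t" "j < p" for i j
  proof -
    have "y i j + real_of_int (nu p t y i) / real p
      = (y i j - y i (p - 1)) + (y i (p - 1) + real_of_int (c i) / real p)"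
      using nu by simp
    then show ?thesis
      using dual_root_lattice_diff_Ints[OF y that(1) that(2), of "p - 1"] int[OF that(1)] p
      by (metis Ints_add diff_less zero_less_one)
  qed
qed

section \<open>Frames of type A\<close>

text \<open>Pairing a linear relation with \<open>w y\<close> isolates the coefficient of
  \<open>r y\<close>.\<close>

lemma biorthogonal_independent:
  fixes r w :: "'i \<Rightarrow> 'a::real_inner"
  assumes "\<And>x y. x \<in> A \<Longrightarrow> y \<in> A \<Longrightarrow> r x \<bullet> w y = (if x = y then 1 else 0)"
  shows "inj_on r A" and "independent (r ` A)"
proof -
  show inj: "inj_on r A"
  proof (rule inj_onI)
    fix x y assume xy: "x \<in> A" "y \<in> A" "r x = r y"
    have "(if y = x then 1 else 0) = (1 :: real)"
      using assms[OF xy(1) xy(1)] assms[OF xy(2) xy(1)] xy(3) by simp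
    then show "x = y" by (metis zero_neq_one)
  qed
  show "independent (r ` A)"
  proof (rule independent_explicit_module[THEN iffD2], intro allI impI)
    fix S c v assume S: "finite S" "S \<subseteq> r ` A" "(\<Sum>v\<in>S. c v *\<^sub>R v) = 0" "v \<in> S"
    then obtain y where y: "y \<in> A" "v = r y" by auto
    have "0 = (\<Sum>v\<in>S. c v *\<^sub>R v) \<bullet> w y" using S by simp
    also have "\<dots> = (\<Sum>v'\<in>S. c v' * (v' \<bullet> w y))" by (simp add: inner_sum_left)
    also have "\<dots> = (\<Sum>v'\<in>S. if v' = v then c v' else 0)"
    proof (intro sum.cong refl)
      fix v' assume "v' \<in> S"
      then obtain x where "x \<in> A" "v' = r x" using S by auto
      then show "c v' * (v' \<bullet> w y) = (if v' = v then c v' else 0)"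
        using assms[of x y] y inj by (simp add: inj_on_eq_iff)
    qed
    also have "\<dots> = c v" using S by simp
    finally show "c v = 0" by simp
  qed
qed

text \<open>The vectors \<open>u i j\<close> play the role of the projections of the \<open>v\<^sub>j\<close> to the \<open>i\<close>-th copy of
  \<open>\<real> \<otimes> A\<^bsub>p-1\<^esub>\<close>.\<close>

locale cyclic_frame =
  fixes p :: nat and I :: "'i set" and u :: "'i \<Rightarrow> nat \<Rightarrow> 'a::euclidean_space"
  assumes p_pos: "0 < p" and finite_I: "finite I"
    and gram: "\<And>i k j l. i \<in> I \<Longrightarrow> k \<in> I \<Longrightarrow> j < p \<Longrightarrow> l < p \<Longrightarrow>
      u i j \<bullet> u k l = (if i = k then (if j = l then 1 else 0) - 1 / real p else 0)"
begin

text \<open>The Gram matrix gives this sum norm 0, and the form is definite.\<close>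

lemma sum_u:
  assumes "i \<in> I"
  shows "(\<Sum>j<p. u i j) = 0"
proof -
  have "(\<Sum>j<p. u i j) \<bullet> (\<Sum>j<p. u i j) = (\<Sum>j<p. \<Sum>l<p. (if l = j then 1 else 0) - 1 / real p)"
    using assms by (simp add: inner_sum_left inner_sum_right gram)
  also have "\<dots> = 0"
    using p_pos by (simp add: sum_subtractf)
  finally show ?thesis by simp
qed

lemma root_inner_u:
  assumes "i \<in> I" "k \<in> I" "a < p" "b < p" "c < p"
  shows "(u i a - u i b) \<bullet> u k c = (if i = k then (if a = c then 1 else 0) - (if b = c then 1 else 0) else 0)"
  using assms by (simp add: inner_diff_left gram)

definition base_vector :: "'i \<times> nat \<Rightarrow> 'a" where
  "base_vector = (\<lambda>(i, j). u i j - u i (Suc j))"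

text \<open>The partial sums of the \<open>u k c\<close> are the fundamental weights, the dual
  family of the simple roots; this yields independence before anything is known about the
  rank.\<close>

lemma base_vector_biorthogonal:
  assumes "x \<in> I \<times> {..<p - 1}" "y \<in> I \<times> {..<p - 1}"
  shows "base_vector x \<bullet> (case y of (k, l) \<Rightarrow> \<Sum>c\<le>l. u k c) = (if x = y then 1 else 0)"
proof -
  obtain i j k l where x: "x = (i, j)" and y: "y = (k, l)" by (cases x, cases y)
  have ij: "i \<in> I" "k \<in> I" "Suc j < p" "Suc l < p" using assms x y by auto
  have "base_vector x \<bullet> (\<Sum>c\<le>l. u k c)
    = (\<Sum>c\<le>l. if i = k then (if j = c then 1 else 0) - (if Suc j = c then 1 else 0) else 0)"
    unfolding inner_sum_right x base_vector_def
    using ij by (intro sum.cong) (auto simp: root_inner_u)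
  also have "\<dots> = (if x = y then 1 else 0)"
    using x y by (cases "i = k") (auto simp: sum_subtractf)
  finally show ?thesis using y by simp
qed

lemma inj_base_vector: "inj_on base_vector (I \<times> {..<p - 1})"
  and independent_base_vectors: "independent (base_vector ` (I \<times> {..<p - 1}))"
  using biorthogonal_independent[OF base_vector_biorthogonal] by blast+

lemma card_base_vectors: "card (base_vector ` (I \<times> {..<p - 1})) = card I * (p - 1)"
  using card_image[OF inj_base_vector] finite_I by (simp add: card_cartesian_product)

text \<open>Each component occupies p - 1 dimensions; later this bounds the number of orbits in one
  coset of \<open>L\<close>.\<close>

lemma card_components_le: "card I * (p - 1) \<le> DIM('a)"
  using independent_bound[OF independent_base_vectors] card_base_vectors by simp

definition root :: "'i \<times> nat \<times> nat \<Rightarrow> 'a" where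
  "root = (\<lambda>(i, a, b). u i a - u i b)"

definition root_index :: "('i \<times> nat \<times> nat) set" where
  "root_index = I \<times> (SIGMA a:{..<p}. {..<p} - {a})"

text \<open>A root is recovered from its pairings with the frame: the value 1 occurs only at
  \<open>u i a\<close> and the value -1 only at \<open>u i b\<close>.\<close>

lemma inj_root: "inj_on root root_index"
proof (rule inj_onI)
  fix x y assume "x \<in> root_index" "y \<in> root_index" and eq: "root x = root y"
  moreover obtain i a b where x: "x = (i, a, b)" by (cases x)
  moreover obtain k c d where y: "y = (k, c, d)" by (cases y)
  ultimately have *: "i \<in> I" "a < p" "b < p" "k \<in> I" "c < p" "d < p" "a \<noteq> b" "c \<noteq> d"
    by (auto simp: root_index_def)
  have "(u i a - u i b) \<bullet> u k c = 1" "(u i a - u i b) \<bullet> u k d = -1"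
    using * eq root_inner_u[of k k c d c] root_inner_u[of k k c d d] by (auto simp: root_def x y)
  then show "x = y"
    using * root_inner_u[of i k a b c] root_inner_u[of i k a b d] by (auto simp: x y split: if_splits)
qed

lemma card_roots: "card (root ` root_index) = card I * (p * (p - 1))"
  using card_image[OF inj_root] finite_I
  by (simp add: root_index_def card_cartesian_product)

lemma root_norm:
  assumes "x \<in> root_index"
  shows "root x \<bullet> root x = 2"
proof -
  obtain i a b where x: "x = (i, a, b)" by (cases x)
  have "i \<in> I" "a < p" "b < p" "a \<noteq> b" using assms x by (auto simp: root_index_def)
  then show ?thesis
    using x by (simp add: root_def inner_diff_right root_inner_u)
qed

lemma u_diff_telescope:
  assumes "a \<le> b"
  shows "u i a - u i b = (\<Sum>j\<in>{a..<b}. base_vector (i, j))"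
  using assms
proof (induction b rule: dec_induct)
  case (step b)
  then show ?case by (simp add: base_vector_def atLeastLessThanSuc algebra_simps)
qed simp

text \<open>The \<open>u i j\<close> sum to 0 in each component, so they are no basis, but they form
  a tight frame: the operator on the left fixes every simple root, and at full rank these
  span.\<close>

lemma parseval:
  assumes "card I * (p - 1) = DIM('a)"
  shows "(\<Sum>i\<in>I. \<Sum>j<p. (x \<bullet> u i j) *\<^sub>R u i j) = x"
proof -
  define T where "T = (\<lambda>x. \<Sum>i\<in>I. \<Sum>j<p. (x \<bullet> u i j) *\<^sub>R u i j)"
  have lin: "linear T"
    unfolding T_def
    by (auto simp: linear_iff inner_add_left scaleR_add_left sum.distrib scaleR_sum_right)
  have fixed: "T r = r" if "r \<in> base_vector ` (I \<times> {..<p - 1})" for r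
  proof -
    obtain k l where k: "k \<in> I" "Suc l < p" and r: "r = u k l - u k (Suc l)"
      using \<open>r \<in> _\<close> by (auto simp: base_vector_def less_diff_conv)
    have "T r = (\<Sum>i\<in>I. if k = i then \<Sum>j<p. (if l = j then u i j else 0) - (if Suc l = j then u i j else 0) else 0)"
      unfolding T_def r using k
      by (intro sum.cong refl) (auto simp: root_inner_u intro!: sum.cong)
    also have "\<dots> = r"
      using k finite_I by (simp add: sum_subtractf r)
    finally show ?thesis .
  qed
  have "UNIV \<subseteq> span (base_vector ` (I \<times> {..<p - 1}))"
    by (rule card_ge_dim_independent[OF _ independent_base_vectors]) (use card_base_vectors assms in auto)
  then have "T x = id x"
    using linear_eq_on[OF lin linear_id, of x "base_vector ` (I \<times> {..<p - 1})"] fixed by auto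
  then show ?thesis by (simp add: T_def)
qed

end

section \<open>Pairings modulo the integers: words, the Weyl vector and the cyclic shift\<close>

lemma mod_quotient_diff_Ints:
  assumes "0 < p"
  shows "real_of_int a / real p - real_of_int (a mod int p) / real p \<in> \<int>"
proof -
  have "real_of_int a = real p * real_of_int (a div int p) + real_of_int (a mod int p)"
    by (metis mult_div_mod_eq of_int_add of_int_mult of_int_of_nat_eq)
  then have "real_of_int a / real p - real_of_int (a mod int p) / real p = real_of_int (a div int p)"
    using assms by (simp add: field_simps)
  then show ?thesis by simp
qed

lemma mod_eq_0_if_quotient_Ints:
  assumes "0 < p" "real_of_int a / real p \<in> \<int>"
  shows "a mod int p = 0"
proof -
  have "real_of_int (a mod int p) / real p \<in> \<int>"
    using Ints_diff[OF assms(2) mod_quotient_diff_Ints[OF assms(1), of a]] by simp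
  then show ?thesis
    using int_eq_if_quotient_diff_Ints[OF assms(1), of "a mod int p" 0] assms(1) by simp
qed

lemma bform_diff_right: "bform p t x (\<lambda>i j. y i j - z i j) = bform p t x y - bform p t x z"
  by (simp add: bform_def algebra_simps sum_subtractf)

lemma bform_commute: "bform p t x y = bform p t y x"
  by (simp add: bform_def mult.commute)

text \<open>Adding \<open>?c i / p\<close> and \<open>?d i / p\<close> makes all coordinates
  integral. In the product the cross terms vanish, since coordinates sum to 0, and the p constant
  terms add up to \<open>?c i * ?d i / p\<close>.\<close>

lemma bform_plus_word_pairing_Ints:
  assumes p: "0 < p" and y: "y \<in> dual_root_lattice p t" and z: "z \<in> dual_root_lattice p t"
  shows "bform p t y z + real_of_int (\<Sum>i<t. nu p t y i * nu p t z i) / real p \<in> \<int>"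
proof -
  let ?c = "\<lambda>i. real_of_int (nu p t y i)" and ?d = "\<lambda>i. real_of_int (nu p t z i)"
  have "(\<Sum>j<p. y i j * z i j) + ?c i * ?d i / real p \<in> \<int>" if i: "i < t" for i
  proof -
    let ?m = "\<lambda>j. y i j + ?c i / real p" and ?n = "\<lambda>j. z i j + ?d i / real p"
    have sums: "(\<Sum>j<p. y i j) = 0" "(\<Sum>j<p. z i j) = 0"
      using y z i by (auto simp: dual_root_lattice_def ambient_def)
    have "(\<Sum>j<p. ?m j * ?n j) = (\<Sum>j<p. y i j * z i j) + (\<Sum>j<p. y i j) * (?d i / real p)
        + ?c i / real p * (\<Sum>j<p. z i j) + real p * (?c i / real p * (?d i / real p))"
      by (simp only: sum.distrib distrib_left distrib_right sum_distrib_left sum_distrib_right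
          sum_constant card_lessThan add.assoc)
    also have "\<dots> = (\<Sum>j<p. y i j * z i j) + ?c i * ?d i / real p"
      using sums p by simp
    finally have "(\<Sum>j<p. y i j * z i j) + ?c i * ?d i / real p = (\<Sum>j<p. ?m j * ?n j)" ..
    also have "\<dots> \<in> \<int>"
      using nu_carrier_and_Ints(2)[OF p y i] nu_carrier_and_Ints(2)[OF p z i]
      by (intro Ints_sum Ints_mult) auto
    finally show ?thesis .
  qed
  then have "(\<Sum>i<t. (\<Sum>j<p. y i j * z i j) + ?c i * ?d i / real p) \<in> \<int>"
    by (intro Ints_sum) auto
  then show ?thesis
    by (simp add: bform_def sum.distrib sum_divide_distrib)
qed

lemma sum_cyc:
  assumes "0 < p"
  shows "(\<Sum>j<p. cyc p a j * b j) = (\<Sum>j<p - 1. a j * b (Suc j)) + a (p - 1) * b 0"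
proof -
  obtain n where n: "p = Suc n" using assms gr0_implies_Suc by blast
  show ?thesis
    unfolding n by (subst sum.lessThan_Suc_shift) (simp add: cyc_def)
qed

lemma weyl_chi_step:
  assumes "i < t" "Suc j < p"
  shows "weyl_chi p t i j - weyl_chi p t i (Suc j) = 1 / real p"
proof -
  have "weyl_chi p t i j - weyl_chi p t i (Suc j)
    = 1 / real p * ((real p - 1 - 2 * real j) / 2 - (real p - 1 - 2 * real (Suc j)) / 2)"
    using assms by (simp only: weyl_chi_def right_diff_distrib) simp
  also have "(real p - 1 - 2 * real j) / 2 - (real p - 1 - 2 * real (Suc j)) / 2 = 1"
    by (simp add: field_simps)
  finally show ?thesis by simp
qed

text \<open>For \<open>j < p - 1\<close> the coordinates of \<open>\<chi>\<close> drop by \<open>1/p\<close>, so one cyclic shift changes the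
  pairing with \<open>\<chi>\<close> exactly by the last coordinate.\<close>

lemma cyc_weyl_chi:
  assumes p: "0 < p" and i: "i < t" and a: "(\<Sum>j<p. a j) = 0"
  shows "(\<Sum>j<p. cyc p a j * weyl_chi p t i j) = (\<Sum>j<p. a j * weyl_chi p t i j) + a (p - 1)"
proof -
  let ?\<chi> = "weyl_chi p t i"
  obtain n where n: "p = Suc n" using p gr0_implies_Suc by blast
  have "(\<Sum>j<p. cyc p a j * ?\<chi> j) - (\<Sum>j<p. a j * ?\<chi> j)
      = (\<Sum>j<n. a j * (?\<chi> (Suc j) - ?\<chi> j)) + a n * (?\<chi> 0 - ?\<chi> n)"
    using sum_cyc[OF p, of a ?\<chi>] n by (simp add: sum_subtractf algebra_simps)
  also have "(\<Sum>j<n. a j * (?\<chi> (Suc j) - ?\<chi> j)) = (\<Sum>j<n. - (1 / real p) * a j)"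
  proof (intro sum.cong refl)
    fix j assume "j \<in> {..<n}"
    then have "?\<chi> (Suc j) - ?\<chi> j = - (1 / real p)"
      using weyl_chi_step[OF i, of j p] n by simp
    then show "a j * (?\<chi> (Suc j) - ?\<chi> j) = - (1 / real p) * a j" by simp
  qed
  also have "\<dots> = - (1 / real p) * (\<Sum>j<n. a j)"
    by (simp add: sum_distrib_left)
  also have "(\<Sum>j<n. a j) = - a n"
    using a n by simp
  \<comment> \<open>The jump at the wraparound is 1 - 1/p instead of -1/p; the excess 1 is what
    contributes the last coordinate.\<close>
  also have "?\<chi> 0 - ?\<chi> n = real n / real p"
  proof -
    have "?\<chi> 0 - ?\<chi> n = 1 / real p * ((real p - 1 - 2 * real 0) / 2 - (real p - 1 - 2 * real n) / 2)"
      using i n by (simp only: weyl_chi_def right_diff_distrib) simp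
    also have "(real p - 1 - 2 * real 0) / 2 - (real p - 1 - 2 * real n) / 2 = real n"
      by (simp add: field_simps)
    finally show ?thesis by simp
  qed
  also have "real n = real p - 1" using n by simp
  also have "- (1 / real p) * - a n + a n * ((real p - 1) / real p) = a n"
    using p by (simp add: field_simps)
  finally show ?thesis using n by simp
qed

text \<open>Each shift adds the last coordinate of the current vector to the pairing, and this is
  \<open>-c/p\<close> modulo the integers. The first two conjuncts keep the assumptions alive during
  the induction.\<close>

lemma cyc_pow_weyl_chi:
  fixes c :: int
  assumes p: "0 < p" and i: "i < t"
    and a: "(\<Sum>j<p. a j) = 0" "\<And>j. j < p \<Longrightarrow> a j + real_of_int c / real p \<in> \<int>"
  shows "(\<Sum>j<p. (cyc p ^^ n) a j) = 0 \<and> (\<forall>j<p. (cyc p ^^ n) a j + real_of_int c / real p \<in> \<int>) \<and>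
    (\<Sum>j<p. (cyc p ^^ n) a j * weyl_chi p t i j) - (\<Sum>j<p. a j * weyl_chi p t i j)
      + real n * real_of_int c / real p \<in> \<int>"
proof (induction n)
  case 0
  then show ?case using a by simp
next
  case (Suc n)
  let ?b = "(cyc p ^^ n) a"
  have 1: "(\<Sum>j<p. cyc p ?b j) = 0"
  proof -
    obtain m where m: "p = Suc m" using p gr0_implies_Suc by blast
    show ?thesis
      using sum_cyc[OF p, of ?b "\<lambda>_. 1"] Suc by (simp add: m)
  qed
  have 2: "cyc p ?b j + real_of_int c / real p \<in> \<int>" if "j < p" for j
  proof -
    have "cyc p ?b j = ?b (if j = 0 then p - 1 else j - 1)"
      using that by (simp only: cyc_def) simp
    then show ?thesis using Suc that p by simp
  qed
  have "?b (p - 1) + real_of_int c / real p \<in> \<int>" using Suc p by simp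
  moreover have "(\<Sum>j<p. ?b j * weyl_chi p t i j) - (\<Sum>j<p. a j * weyl_chi p t i j)
      + real n * real_of_int c / real p \<in> \<int>"
    using Suc by blast
  ultimately have "?b (p - 1) + real_of_int c / real p + ((\<Sum>j<p. ?b j * weyl_chi p t i j)
      - (\<Sum>j<p. a j * weyl_chi p t i j) + real n * real_of_int c / real p) \<in> \<int>"
    by (rule Ints_add)
  moreover have "(\<Sum>j<p. cyc p ?b j * weyl_chi p t i j) = (\<Sum>j<p. ?b j * weyl_chi p t i j) + ?b (p - 1)"
    using Suc by (intro cyc_weyl_chi[OF p i]) auto
  ultimately have "(\<Sum>j<p. cyc p ?b j * weyl_chi p t i j) - (\<Sum>j<p. a j * weyl_chi p t i j)
      + real (Suc n) * real_of_int c / real p \<in> \<int>"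
    by (simp add: algebra_simps add_divide_distrib)
  then show ?case using 1 2 by simp
qed

text \<open>Summed over the components, the changes caused by \<open>e i\<close> shifts assemble to
  the word pairing of \<open>e\<close> with \<open>nu p t y\<close>; this links Construction B to
  the dual code.\<close>

lemma bform_g_std_weyl_chi:
  assumes p: "0 < p" and y: "y \<in> dual_root_lattice p t" and e: "e \<in> carrier (word_group p t)"
  shows "bform p t (g_std p t e y) (weyl_chi p t) - bform p t y (weyl_chi p t)
    + real_of_int (\<Sum>i<t. e i * nu p t y i) / real p \<in> \<int>"
proof -
  have "(\<Sum>j<p. g_std p t e y i j * weyl_chi p t i j) - (\<Sum>j<p. y i j * weyl_chi p t i j)
      + real_of_int (e i * nu p t y i) / real p \<in> \<int>" if i: "i < t" for i
  proof -
    have "(\<Sum>j<p. y i j) = 0" using y i by (auto simp: dual_root_lattice_def ambient_def)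
    moreover have "real (nat (e i)) = real_of_int (e i)"
      using e p i by (simp add: carrier_word_group PiE_iff)
    ultimately show ?thesis
      using cyc_pow_weyl_chi[OF p i, of "y i" "nu p t y i" "nat (e i)"]
        nu_carrier_and_Ints(2)[OF p y i] i by (simp add: g_std_def)
  qed
  then have "(\<Sum>i<t. (\<Sum>j<p. g_std p t e y i j * weyl_chi p t i j) - (\<Sum>j<p. y i j * weyl_chi p t i j)
      + real_of_int (e i * nu p t y i) / real p) \<in> \<int>"
    by (intro Ints_sum) auto
  then show ?thesis
    by (simp add: bform_def sum.distrib sum_subtractf sum_divide_distrib)
qed

section \<open>An integral lattice containing the roots of a full frame, and Constructions A and
  B\<close>

locale lattice_frame = cyclic_frame p "{..<t}" u
  for p t :: nat and u :: "nat \<Rightarrow> nat \<Rightarrow> 'a::euclidean_space" +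
  fixes N :: "'a set"
  assumes full: "t * (p - 1) = DIM('a)"
    and N_zero: "0 \<in> N" and N_diff: "\<And>x y. x \<in> N \<Longrightarrow> y \<in> N \<Longrightarrow> x - y \<in> N"
    and N_integral: "\<And>x y. x \<in> N \<Longrightarrow> y \<in> N \<Longrightarrow> x \<bullet> y \<in> \<int>"
    and base_in_N: "\<And>i j. i < t \<Longrightarrow> Suc j < p \<Longrightarrow> u i j - u i (Suc j) \<in> N"
begin

lemma N_minus: "x \<in> N \<Longrightarrow> - x \<in> N"
  using N_diff[OF N_zero] by force

lemma N_add: "x \<in> N \<Longrightarrow> y \<in> N \<Longrightarrow> x + y \<in> N"
  using N_diff[of x "- y"] N_minus by simp

lemma N_sum: "(\<And>i. i \<in> A \<Longrightarrow> h i \<in> N) \<Longrightarrow> sum h A \<in> N"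
  by (induction A rule: infinite_finite_induct) (auto intro: N_zero N_add)

lemma N_scale:
  assumes "x \<in> N"
  shows "real_of_int k *\<^sub>R x \<in> N"
proof (induction k rule: int_induct[of _ 0])
  case (step1 i)
  then show ?case using N_add[OF _ assms] by (simp add: scaleR_add_left)
next
  case (step2 i)
  then show ?case using N_diff[OF _ assms] by (simp add: scaleR_diff_left)
qed (simp add: N_zero)

lemma u_diff_in_N:
  assumes "i < t" "a < p" "b < p"
  shows "u i a - u i b \<in> N"
proof -
  have le: "u i a - u i b \<in> N" if "a \<le> b" "b < p" for a b
    unfolding u_diff_telescope[OF that(1)]
    using that assms(1) base_in_N by (intro N_sum) (auto simp: base_vector_def)
  show ?thesis
    using le[of a b] le[of b a] N_minus[of "u i b - u i a"] assms by (cases "a \<le> b") auto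
qed

text \<open>As \<open>u i j\<close> is a projected standard basis vector, pairing with it reads off
  the coefficient of that basis vector.\<close>

definition coords :: "'a \<Rightarrow> bvec" where
  "coords x = (\<lambda>i j. if i < t \<and> j < p then x \<bullet> u i j else 0)"

lemma coords_add: "coords (x + y) = (\<lambda>i j. coords x i j + coords y i j)"
  by (auto simp: coords_def inner_add_left fun_eq_iff)

lemma coords_diff: "coords (x - y) = (\<lambda>i j. coords x i j - coords y i j)"
  by (auto simp: coords_def inner_diff_left fun_eq_iff)

lemma bform_coords: "bform p t (coords x) (coords y) = x \<bullet> y"
proof -
  have "bform p t (coords x) (coords y) = (\<Sum>i<t. \<Sum>j<p. (x \<bullet> u i j) *\<^sub>R u i j) \<bullet> y"
    by (simp add: bform_def coords_def inner_sum_left inner_commute[of "u i j" y for i j])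
  then show ?thesis using parseval[of x] full by simp
qed

lemma coords_ambient: "coords x \<in> ambient p t"
proof -
  have "(\<Sum>j<p. coords x i j) = 0" if "i < t" for i
    using that sum_u[of i] by (simp add: coords_def flip: inner_sum_right)
  then show ?thesis by (auto simp: ambient_def coords_def)
qed

lemma coords_base_vector:
  assumes "i < t" "Suc j < p"
  shows "coords (base_vector (i, j)) = simple_root i j"
  using assms by (auto simp: fun_eq_iff coords_def base_vector_def simple_root_def root_inner_u)

definition from_coords :: "bvec \<Rightarrow> 'a" where
  "from_coords z = (\<Sum>i<t. \<Sum>j<p. z i j *\<^sub>R u i j)"

text \<open>The terms \<open>1/p\<close> of the Gram matrix collect to a multiple of the coordinate
  sum of a component, which is 0 on \<open>ambient p t\<close>.\<close>

lemma coords_from_coords: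
  assumes "z \<in> ambient p t"
  shows "coords (from_coords z) = z"
proof (intro ext)
  fix k l
  show "coords (from_coords z) k l = z k l"
  proof (cases "k < t \<and> l < p")
    case True
    have "from_coords z \<bullet> u k l
      = (\<Sum>i<t. if k = i then \<Sum>j<p. (if l = j then z i j else 0) - z i j * (1 / real p) else 0)"
      unfolding from_coords_def inner_sum_left using True
      by (intro sum.cong refl) (auto simp: gram right_diff_distrib intro!: sum.cong)
    also have "\<dots> = z k l - (\<Sum>j<p. z k j) * (1 / real p)"
      using True by (simp add: sum_subtractf sum_divide_distrib)
    also have "\<dots> = z k l"
      using assms True by (simp add: ambient_def)
    finally show ?thesis using True by (simp add: coords_def)
  next
    case False
    then show ?thesis using assms by (auto simp: coords_def ambient_def)
  qed
qed

lemma from_coords_in_N: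
  assumes "z \<in> root_lattice p t"
  shows "from_coords z \<in> N"
  unfolding from_coords_def
proof (rule N_sum)
  fix i assume "i \<in> {..<t}"
  then have i: "i < t" by simp
  \<comment> \<open>Only differences of the \<open>u i j\<close> are known to lie in
    \<open>N\<close>; as the coordinates sum to 0, \<open>u i 0\<close> may be subtracted in every
    term.\<close>
  have "(\<Sum>j<p. z i j *\<^sub>R u i j) = (\<Sum>j<p. z i j *\<^sub>R (u i j - u i 0)) + (\<Sum>j<p. z i j) *\<^sub>R u i 0"
    by (simp add: scaleR_diff_right sum_subtractf scaleR_sum_left)
  also have "(\<Sum>j<p. z i j) = 0"
    using assms i by (simp add: root_lattice_def ambient_def)
  also have "(\<Sum>j<p. z i j *\<^sub>R (u i j - u i 0)) + 0 *\<^sub>R u i 0 \<in> N"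
  proof -
    have "z i j *\<^sub>R (u i j - u i 0) \<in> N" if "j < p" for j
    proof -
      have "z i j \<in> \<int>" using assms by (simp add: root_lattice_def)
      then show ?thesis
        using N_scale[OF u_diff_in_N[OF i that p_pos]] by (auto elim: Ints_cases)
    qed
    then show ?thesis by (auto intro: N_sum)
  qed
  finally show "(\<Sum>j<p. z i j *\<^sub>R u i j) \<in> N" .
qed

text \<open>The frame generates R inside \<open>N\<close>, and \<open>N\<close> is integral, so
  \<open>N\<close> lies in the dual of R.\<close>

lemma coords_dual:
  assumes "x \<in> N"
  shows "coords x \<in> dual_root_lattice p t"
proof -
  have "bform p t (coords x) z \<in> \<int>" if "z \<in> root_lattice p t" for z
  proof -
    have "coords (from_coords z) = z"
      using that by (intro coords_from_coords) (simp add: root_lattice_def)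
    then show ?thesis
      using bform_coords[of x "from_coords z"] N_integral[OF assms from_coords_in_N[OF that]] by simp
  qed
  then show ?thesis by (simp add: dual_root_lattice_def coords_ambient)
qed

definition code :: "(nat \<Rightarrow> int) set" where
  "code = (\<lambda>x. nu p t (coords x)) ` N"

lemma group_word_group: "group (word_group p t)"
  by (simp add: word_group_def)

text \<open>Words are residues of p times the last coordinates up to sign, so the word map is
  additive on \<open>N\<close> and its image is a subgroup.\<close>

lemma is_code_code: "is_code p t code"
  unfolding is_code_def
proof (rule group.subgroupI[OF group_word_group])
  show "code \<subseteq> carrier (word_group p t)"
    using nu_carrier_and_Ints(1)[OF p_pos coords_dual] by (auto simp: code_def)
  show "code \<noteq> {}" using N_zero by (auto simp: code_def)
next
  fix c assume "c \<in> code"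
  then obtain x where x: "x \<in> N" "c = nu p t (coords x)" by (auto simp: code_def)
  have c: "c \<in> carrier (word_group p t)"
    using nu_carrier_and_Ints(1)[OF p_pos coords_dual] x by simp
  have "inv\<^bsub>word_group p t\<^esub> c = (\<lambda>i\<in>{..<t}. (- c i) mod int p)"
    using c unfolding word_group_def
    by (subst inv_product_group) (auto simp: PiE_iff intro!: restrict_ext)
  also have "\<dots> = nu p t (coords (- x))"
  proof (rule nu_eqI[symmetric])
    fix i assume i: "i < t"
    have "coords x i (p - 1) + real_of_int (c i) / real p \<in> \<int>"
      using nu_carrier_and_Ints(2)[OF p_pos coords_dual[OF x(1)] i, of "p - 1"] p_pos x(2) by simp
    from Ints_diff[OF Ints_minus[OF this] mod_quotient_diff_Ints[OF p_pos, of "- c i"]]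
    have "- coords x i (p - 1) + real_of_int ((- c i) mod int p) / real p \<in> \<int>" by simp
    then show "coords (- x) i (p - 1) + real_of_int ((\<lambda>i\<in>{..<t}. (- c i) mod int p) i) / real p \<in> \<int>"
      using i p_pos by (simp add: coords_def)
  qed (use p_pos x N_minus coords_dual in \<open>auto simp: carrier_word_group\<close>)
  finally show "inv\<^bsub>word_group p t\<^esub> c \<in> code" using N_minus x by (simp add: code_def)
next
  fix c d assume "c \<in> code" "d \<in> code"
  then obtain x y where x: "x \<in> N" "c = nu p t (coords x)" and y: "y \<in> N" "d = nu p t (coords y)"
    by (auto simp: code_def)
  have "c \<otimes>\<^bsub>word_group p t\<^esub> d = (\<lambda>i\<in>{..<t}. (c i + d i) mod int p)"
    by (simp add: word_group_def)
  also have "\<dots> = nu p t (coords (x + y))"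
  proof (rule nu_eqI[symmetric])
    fix i assume i: "i < t"
    have "coords x i (p - 1) + real_of_int (c i) / real p \<in> \<int>"
      using nu_carrier_and_Ints(2)[OF p_pos coords_dual[OF x(1)] i, of "p - 1"] p_pos x(2) by simp
    moreover have "coords y i (p - 1) + real_of_int (d i) / real p \<in> \<int>"
      using nu_carrier_and_Ints(2)[OF p_pos coords_dual[OF y(1)] i, of "p - 1"] p_pos y(2) by simp
    ultimately have "(coords x i (p - 1) + real_of_int (c i) / real p)
        + (coords y i (p - 1) + real_of_int (d i) / real p)
        - (real_of_int (c i + d i) / real p - real_of_int ((c i + d i) mod int p) / real p) \<in> \<int>"
      using mod_quotient_diff_Ints[OF p_pos, of "c i + d i"] by (intro Ints_diff[OF Ints_add])
    then show "coords (x + y) i (p - 1) + real_of_int ((\<lambda>i\<in>{..<t}. (c i + d i) mod int p) i) / real p \<in> \<int>"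
      using i by (simp add: coords_add add_divide_distrib algebra_simps)
  qed (use p_pos x y N_add coords_dual in \<open>auto simp: carrier_word_group\<close>)
  finally show "c \<otimes>\<^bsub>word_group p t\<^esub> d \<in> code" using N_add x y by (simp add: code_def)
qed

text \<open>Modulo the integers the form on \<open>N\<close> is minus the word pairing divided by p,
  and \<open>N\<close> is integral.\<close>

lemma self_orthogonal_code: "self_orthogonal p t code"
  unfolding self_orthogonal_def
proof
  fix c assume c: "c \<in> code"
  then obtain x where x: "x \<in> N" "c = nu p t (coords x)" by (auto simp: code_def)
  have "(\<Sum>i<t. c i * d i) mod int p = 0" if "d \<in> code" for d
  proof (rule mod_eq_0_if_quotient_Ints[OF p_pos])
    from that obtain y where y: "y \<in> N" "d = nu p t (coords y)" by (auto simp: code_def)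
    show "real_of_int (\<Sum>i<t. c i * d i) / real p \<in> \<int>"
      using Ints_diff[OF bform_plus_word_pairing_Ints[OF p_pos coords_dual[OF x(1)] coords_dual[OF y(1)]]
          N_integral[OF x(1) y(1)]] by (simp add: bform_coords x(2) y(2))
  qed
  then show "c \<in> dual_code p t code"
    using nu_carrier_and_Ints(1)[OF p_pos coords_dual[OF x(1)]] x(2) by (simp add: dual_code_def)
qed

text \<open>Two vectors of the dual of R with the same word differ by an element of R, and R is
  contained in the image of \<open>N\<close>.\<close>

lemma coords_image: "coords ` N = constr_A p t code"
proof (intro equalityI subsetI)
  fix y assume y: "y \<in> constr_A p t code"
  then have dual: "y \<in> dual_root_lattice p t" by (simp add: constr_A_def)
  from y obtain x where x: "x \<in> N" "nu p t y = nu p t (coords x)"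
    by (auto simp: constr_A_def code_def)
  let ?z = "\<lambda>i j. y i j - coords x i j"
  have amb: "?z \<in> ambient p t"
    using dual coords_ambient[of x] by (auto simp: dual_root_lattice_def ambient_def sum_subtractf)
  have "?z i j \<in> \<int>" if ij: "i < t" "j < p" for i j
    using Ints_diff[OF nu_carrier_and_Ints(2)[OF p_pos dual ij]
        nu_carrier_and_Ints(2)[OF p_pos coords_dual[OF x(1)] ij]] x(2) by simp
  then have "?z \<in> root_lattice p t" by (rule root_latticeI[OF amb])
  then have "x + from_coords ?z \<in> N" using N_add x(1) from_coords_in_N by blast
  moreover have "y = coords (x + from_coords ?z)"
    by (simp add: coords_add coords_from_coords[OF amb])
  ultimately show "y \<in> coords ` N" by (rule rev_image_eqI)
qed (auto simp: constr_A_def code_def coords_dual)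

lemma coords_isometry: "is_isometry_onto p t N (constr_A p t code) coords"
proof -
  have "inj_on coords N"
  proof (rule inj_onI)
    fix x y assume "coords x = coords y"
    then have "coords (x - y) = (\<lambda>_ _. 0)" by (simp add: coords_diff)
    then have "(x - y) \<bullet> (x - y) = 0"
      using bform_coords[of "x - y" "x - y"] by (simp add: bform_def)
    then show "x = y" by simp
  qed
  then show ?thesis
    by (simp add: is_isometry_onto_def bij_betw_def coords_image coords_add bform_coords)
qed

text \<open>If \<open>c\<close> and \<open>\<chi>\<close> have the same coordinates modulo the integers, then they differ by an
  element of \<open>R \<subseteq> N\<close>, so they have the same pairings with \<open>N\<close> modulo the integers.\<close>

lemma coords_constr_B:
  assumes c_base: "\<And>i j. i < t \<Longrightarrow> Suc j < p \<Longrightarrow> c \<bullet> (u i j - u i (Suc j)) - 1 / real p \<in> \<int>"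
    and c_first: "\<And>i. i < t \<Longrightarrow> c \<bullet> u i 0 - (real p - 1) / (2 * real p) \<in> \<int>"
    and x: "x \<in> N"
  shows "coords x \<in> constr_B p t code \<longleftrightarrow> x \<bullet> c \<in> \<int>"
proof -
  let ?z = "\<lambda>i j. coords c i j - weyl_chi p t i j"
  have chi_sum: "(\<Sum>j<p. weyl_chi p t i j) = 0" if i: "i < t" for i
  proof -
    \<comment> \<open>The induction needs an arbitrary end \<open>n\<close> of the sum with
      \<open>p\<close> fixed; the value vanishes at \<open>n = p\<close>.\<close>
    have "(\<Sum>j<n. real p - 1 - 2 * real j) = real n * (real p - real n)" for n
      by (induction n) (auto simp: algebra_simps)
    from this[of p] show ?thesis
      using i by (simp add: weyl_chi_def flip: sum_distrib_left sum_divide_distrib)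
  qed
  have amb: "?z \<in> ambient p t"
    using coords_ambient[of c] chi_sum by (auto simp: ambient_def sum_subtractf weyl_chi_def)
  have "?z i j \<in> \<int>" if i: "i < t" and j: "j < p" for i j
  proof -
    have "?z i 0 - ?z i j \<in> \<int>"
    proof (rule Ints_diff_of_steps[OF _ p_pos j])
      fix l assume l: "Suc l < p"
      have "?z i l - ?z i (Suc l) = c \<bullet> (u i l - u i (Suc l)) - (weyl_chi p t i l - weyl_chi p t i (Suc l))"
        using i l by (simp add: coords_def inner_diff_right)
      then show "?z i l - ?z i (Suc l) \<in> \<int>"
        using c_base[OF i l] weyl_chi_step[OF i l] by simp
    qed
    moreover have "?z i 0 \<in> \<int>"
      using c_first[OF i] i p_pos by (simp add: coords_def weyl_chi_def mult.commute)
    ultimately show ?thesis using Ints_diff[of "?z i 0" "?z i 0 - ?z i j"] by simp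
  qed
  then have z: "?z \<in> root_lattice p t" by (rule root_latticeI[OF amb])
  have "bform p t (coords x) ?z \<in> \<int>"
    using coords_dual[OF x] z by (auto simp: dual_root_lattice_def)
  then have "x \<bullet> c - bform p t (coords x) (weyl_chi p t) \<in> \<int>"
    by (simp add: bform_diff_right bform_coords)
  then have "x \<bullet> c \<in> \<int> \<longleftrightarrow> bform p t (coords x) (weyl_chi p t) \<in> \<int>"
    by (metis Ints_add Ints_diff diff_add_cancel add_diff_cancel_left')
  moreover have "coords x \<in> constr_A p t code" using coords_image x by blast
  ultimately show ?thesis by (simp add: constr_B_def)
qed

text \<open>By Construction B the vector \<open>g x - x\<close> pairs integrally with \<chi>,
  whereas the shift computation gives minus the word pairing of \<open>e\<close> with the word of
  \<open>x\<close>, divided by p.\<close>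

lemma dual_code_if_shift:
  assumes e: "e \<in> carrier (word_group p t)"
    and g: "\<And>x. x \<in> N \<Longrightarrow> coords (g x) = g_std p t e (coords x)"
    and B: "\<And>x. x \<in> N \<Longrightarrow> coords (g x - x) \<in> constr_B p t code"
  shows "e \<in> dual_code p t code"
proof -
  have "(\<Sum>i<t. e i * c i) mod int p = 0" if "c \<in> code" for c
  proof (rule mod_eq_0_if_quotient_Ints[OF p_pos])
    from that obtain x where x: "x \<in> N" "c = nu p t (coords x)" by (auto simp: code_def)
    have "bform p t (coords (g x - x)) (weyl_chi p t) \<in> \<int>"
      using B[OF x(1)] by (simp add: constr_B_def)
    then have "bform p t (g_std p t e (coords x)) (weyl_chi p t) - bform p t (coords x) (weyl_chi p t) \<in> \<int>"
      by (simp add: coords_diff g[OF x(1)] bform_commute[of _ _ _ "weyl_chi p t"] bform_diff_right)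
    from Ints_diff[OF bform_g_std_weyl_chi[OF p_pos coords_dual[OF x(1)] e] this]
    show "real_of_int (\<Sum>i<t. e i * c i) / real p \<in> \<int>" by (simp add: x(2))
  qed
  then show ?thesis using e by (simp add: dual_code_def)
qed

text \<open>The frame supplies \<open>t * p * (p - 1)\<close> roots, which by full rank is already
  the number of all roots.\<close>

lemma roots_eq:
  assumes "card (vectors_of_norm N 2) = p * DIM('a)"
  shows "vectors_of_norm N 2 = root ` root_index"
proof (rule card_subset_eq[symmetric])
  show "root ` root_index \<subseteq> vectors_of_norm N 2"
    using root_norm u_diff_in_N by (auto simp: vectors_of_norm_def root_index_def root_def)
  show "card (root ` root_index) = card (vectors_of_norm N 2)"
    using assms full by (simp add: card_roots)
  show "finite (vectors_of_norm N 2)"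
    using assms p_pos by (auto intro: card_ge_0_finite)
qed

lemma coords_base: "coords ` base_vector ` ({..<t} \<times> {..<p - 1}) = standard_base p t"
proof (intro equalityI subsetI)
  fix z assume "z \<in> coords ` base_vector ` ({..<t} \<times> {..<p - 1})"
  then obtain i j where "i < t" "Suc j < p" "z = coords (base_vector (i, j))"
    by (auto simp: less_diff_conv)
  then show "z \<in> standard_base p t"
    unfolding standard_base_def using coords_base_vector by blast
next
  fix z assume "z \<in> standard_base p t"
  then obtain i j where ij: "z = simple_root i j" "i < t" "Suc j < p"
    by (auto simp: standard_base_def)
  then have "(i, j) \<in> {..<t} \<times> {..<p - 1}" "z = coords (base_vector (i, j))"
    by (simp_all add: coords_base_vector less_diff_conv)
  then show "z \<in> coords ` base_vector ` ({..<t} \<times> {..<p - 1})" by blast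
qed

text \<open>Up to sign a root telescopes into a sum of consecutive simple roots, so the coefficients
  0 and 1 suffice.\<close>

lemma root_base_base:
  assumes "card (vectors_of_norm N 2) = p * DIM('a)"
  shows "root_base (vectors_of_norm N 2) (base_vector ` ({..<t} \<times> {..<p - 1}))"
proof -
  let ?\<Delta> = "base_vector ` ({..<t} \<times> {..<p - 1})"
  have "?\<Delta> \<subseteq> root ` root_index"
  proof
    fix x assume "x \<in> ?\<Delta>"
    then obtain i j where "i < t" "Suc j < p" "x = root (i, j, Suc j)"
      by (auto simp: base_vector_def root_def less_diff_conv)
    then show "x \<in> root ` root_index" by (auto simp: root_index_def)
  qed
  moreover
  have telescope: "\<exists>c :: 'a \<Rightarrow> nat. u i a - u i b = (\<Sum>\<delta>\<in>?\<Delta>. real (c \<delta>) *\<^sub>R \<delta>)"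
    if "i < t" "a \<le> b" "b < p" for i a b
  proof -
    let ?A = "{i} \<times> {a..<b}"
    have sub: "?A \<subseteq> {..<t} \<times> {..<p - 1}" using that by auto
    have "u i a - u i b = (\<Sum>x\<in>?A. base_vector x)"
      using u_diff_telescope[OF that(2)] by (simp add: sum.cartesian_product' )
    also have "\<dots> = (\<Sum>\<delta>\<in>base_vector ` ?A. \<delta>)"
      using inj_on_subset[OF inj_base_vector sub] by (simp add: sum.reindex)
    also have "\<dots> = (\<Sum>\<delta>\<in>?\<Delta>. real (if \<delta> \<in> base_vector ` ?A then 1 else 0) *\<^sub>R \<delta>)"
      using sub by (intro sum.mono_neutral_cong_left) auto
    finally show ?thesis
      by (intro exI[of _ "\<lambda>\<delta>. if \<delta> \<in> base_vector ` ?A then 1 else 0"])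
  qed
  have "\<exists>c :: 'a \<Rightarrow> nat. \<alpha> = (\<Sum>\<delta>\<in>?\<Delta>. real (c \<delta>) *\<^sub>R \<delta>) \<or> \<alpha> = - (\<Sum>\<delta>\<in>?\<Delta>. real (c \<delta>) *\<^sub>R \<delta>)"
    if \<alpha>: "\<alpha> \<in> root ` root_index" for \<alpha>
  proof -
    obtain i a b where ab: "\<alpha> = u i a - u i b" "i < t" "a < p" "b < p"
      using \<alpha> by (auto simp: root_def root_index_def)
    show ?thesis
    proof (cases "a \<le> b")
      case True
      then show ?thesis using telescope[OF ab(2) True ab(4)] ab(1) by blast
    next
      case False
      then have "b \<le> a" by simp
      from telescope[OF ab(2) this ab(3)] obtain c :: "'a \<Rightarrow> nat"
        where "u i b - u i a = (\<Sum>\<delta>\<in>?\<Delta>. real (c \<delta>) *\<^sub>R \<delta>)" by blast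
      then have "\<alpha> = - (\<Sum>\<delta>\<in>?\<Delta>. real (c \<delta>) *\<^sub>R \<delta>)" using ab(1) by (metis minus_diff_eq)
      then show ?thesis by blast
    qed
  qed
  ultimately show ?thesis
    using independent_base_vectors unfolding root_base_def roots_eq[OF assms] by blast
qed

end

section \<open>Orbits of roots\<close>

lemma sum_lessThan_shift:
  fixes F :: "nat \<Rightarrow> 'a::ab_group_add"
  shows "(\<Sum>l<n. F (Suc l)) = (\<Sum>l<n. F l) + F n - F 0"
  by (induction n) (auto simp: algebra_simps)

lemma orthogonal_transformation_funpow:
  fixes h :: "'a::real_inner \<Rightarrow> 'a"
  shows "orthogonal_transformation h \<Longrightarrow> orthogonal_transformation (h ^^ n)"
proof (induction n)
  case 0
  show ?case by (simp add: orthogonal_transformation_def linear_id)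
next
  case (Suc n)
  then show ?case by (metis funpow.simps(2) orthogonal_transformation_compose)
qed

lemma funpow_eq_id_mod:
  assumes "h ^^ p = id"
  shows "h ^^ n = h ^^ (n mod p)"
proof -
  have "h ^^ n = h ^^ (p * (n div p) + n mod p)" by simp
  also have "\<dots> = (h ^^ p) ^^ (n div p) \<circ> h ^^ (n mod p)"
    by (simp only: funpow_add funpow_mult)
  finally show ?thesis using assms by simp
qed

text \<open>The orbit of a root under an isometry \<open>h\<close> of order \<open>p\<close> forms the affine diagram of type
  \<open>A\<^bsub>p-1\<^esub>\<close>, a cycle of length \<open>p\<close>.\<close>

locale affine_cycle =
  fixes p :: nat and h :: "'a::euclidean_space \<Rightarrow> 'a" and \<alpha> :: 'a
  assumes p_ge: "3 \<le> p" and orth: "orthogonal_transformation h" and order: "h ^^ p = id"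
    and norm_root: "\<alpha> \<bullet> \<alpha> = 2"
    and nonpos: "\<And>j. 0 < j \<Longrightarrow> j < p \<Longrightarrow> \<alpha> \<bullet> (h ^^ j) \<alpha> \<le> 0"
    and neighbour: "\<alpha> \<bullet> h \<alpha> = -1"
    and orbit_sum: "(\<Sum>j<p. (h ^^ j) \<alpha>) = 0"
begin

lemma linear_pow: "linear (h ^^ n)"
  using orthogonal_transformation_funpow[OF orth] orthogonal_transformation_linear by blast

lemma inner_pow: "(h ^^ n) x \<bullet> (h ^^ n) y = x \<bullet> y"
  using orthogonal_transformation_funpow[OF orth] by (simp add: orthogonal_transformation_def)

lemma pow_order: "(h ^^ p) x = x"
  by (simp add: order)

lemma inner_pow_shift:
  assumes "a \<le> b"
  shows "(h ^^ a) x \<bullet> (h ^^ b) y = x \<bullet> (h ^^ (b - a)) y"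
proof -
  have "(h ^^ b) y = (h ^^ a) ((h ^^ (b - a)) y)"
    using assms by (simp flip: funpow_add[THEN fun_cong, unfolded o_apply])
  then show ?thesis by (simp add: inner_pow)
qed

text \<open>The two neighbours, distinct as p is at least 3, contribute -1 each and cancel the norm
  2. The remaining terms are nonpositive with sum 0, so they vanish.\<close>

lemma inner_orbit:
  assumes "j < p"
  shows "\<alpha> \<bullet> (h ^^ j) \<alpha> = (if j = 0 then 2 else if j = 1 \<or> j = p - 1 then -1 else 0)"
proof -
  have last: "\<alpha> \<bullet> (h ^^ (p - 1)) \<alpha> = -1"
  proof -
    have "(h ^^ (p - 1)) \<alpha> \<bullet> (h ^^ p) \<alpha> = \<alpha> \<bullet> (h ^^ (p - (p - 1))) \<alpha>"
      by (rule inner_pow_shift) simp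
    then show ?thesis using p_ge neighbour pow_order by (simp add: inner_commute)
  qed
  let ?A = "{0, 1, p - 1}"
  let ?b = "\<lambda>j. \<alpha> \<bullet> (h ^^ j) \<alpha>"
  have sub: "?A \<subseteq> {..<p}" using p_ge by auto
  have "(\<Sum>j<p. ?b j) = 0"
    using orbit_sum by (simp flip: inner_sum_right)
  also have "(\<Sum>j<p. ?b j) = (\<Sum>j\<in>{..<p} - ?A. ?b j) + (\<Sum>j\<in>?A. ?b j)"
    using sub by (intro sum.subset_diff) auto
  also have "(\<Sum>j\<in>?A. ?b j) = 0"
    using p_ge last neighbour norm_root by simp
  finally have "(\<Sum>j\<in>{..<p} - ?A. - ?b j) = 0" by (simp add: sum_negf)
  then have "\<forall>j\<in>{..<p} - ?A. - ?b j = 0"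
    using nonpos by (subst (asm) sum_nonneg_eq_0_iff) auto
  then show ?thesis using assms last neighbour norm_root by auto
qed

text \<open>The unique vector \<open>w\<close> in the span of the orbit with \<open>w - h w = \<alpha>\<close>, that is, the fundamental
  weight \<open>\<lambda>\<^sub>1\<close> (the projection of \<open>v\<^sub>1\<close>) for the base \<open>\<alpha>, h \<alpha>, h\<^sup>2 \<alpha>, \<dots>\<close>.\<close>

definition weight :: 'a where
  "weight = - (1 / real p) *\<^sub>R (\<Sum>l<p. real l *\<^sub>R (h ^^ l) \<alpha>)"

lemma pow_weight: "(h ^^ j) weight = - (1 / real p) *\<^sub>R (\<Sum>l<p. real l *\<^sub>R (h ^^ (j + l)) \<alpha>)"
  using linear_pow[of j] unfolding weight_def
  by (simp add: linear_scale linear_sum linear_neg funpow_add)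

text \<open>Summation by parts: applying \<open>h\<close> shifts the index, which costs one full
  orbit sum, namely 0, and the boundary term p \<alpha>.\<close>

lemma weight_diff: "weight - h weight = \<alpha>"
proof -
  have "(\<Sum>l<p. real l *\<^sub>R (h ^^ Suc l) \<alpha>)
    = (\<Sum>l<p. real (Suc l) *\<^sub>R (h ^^ Suc l) \<alpha>) - (\<Sum>l<p. (h ^^ Suc l) \<alpha>)"
    by (simp add: algebra_simps flip: sum_subtractf)
  also have "\<dots> = (\<Sum>l<p. real l *\<^sub>R (h ^^ l) \<alpha>) + real p *\<^sub>R \<alpha>"
    unfolding sum_lessThan_shift[of "\<lambda>l. real l *\<^sub>R (h ^^ l) \<alpha>"]
      sum_lessThan_shift[of "\<lambda>l. (h ^^ l) \<alpha>"] by (simp add: pow_order orbit_sum)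
  finally have "h weight = - (1 / real p) *\<^sub>R ((\<Sum>l<p. real l *\<^sub>R (h ^^ l) \<alpha>) + real p *\<^sub>R \<alpha>)"
    using pow_weight[of 1] by simp
  then have "h weight = weight - (1 / real p) *\<^sub>R real p *\<^sub>R \<alpha>"
    unfolding weight_def scaleR_add_right by simp
  then show ?thesis using p_ge by simp
qed

lemma pow_weight_diff: "(h ^^ j) weight - (h ^^ Suc j) weight = (h ^^ j) \<alpha>"
proof -
  have "(h ^^ Suc j) weight = (h ^^ j) (h weight)"
    by (simp add: funpow_swap1)
  then have "(h ^^ j) weight - (h ^^ Suc j) weight = (h ^^ j) (weight - h weight)"
    using linear_diff[OF linear_pow[of j], of weight "h weight"] by simp
  then show ?thesis by (simp add: weight_diff)
qed

text \<open>After exchanging the sums, each inner sum is a translated orbit sum, hence 0.\<close>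

lemma sum_pow_weight: "(\<Sum>j<p. (h ^^ j) weight) = 0"
proof -
  have "(\<Sum>j<p. (h ^^ (j + l)) \<alpha>) = 0" for l
  proof -
    have "(\<Sum>j<p. (h ^^ (j + l)) \<alpha>) = (h ^^ l) (\<Sum>j<p. (h ^^ j) \<alpha>)"
      using linear_pow[of l] by (simp add: linear_sum add.commute[of _ l] funpow_add)
    then show ?thesis using linear_0[OF linear_pow] orbit_sum by simp
  qed
  then have "(\<Sum>l<p. real l *\<^sub>R (\<Sum>j<p. (h ^^ (j + l)) \<alpha>)) = 0" by simp
  then have "(\<Sum>j<p. \<Sum>l<p. real l *\<^sub>R (h ^^ (j + l)) \<alpha>) = 0"
    by (subst sum.swap) (simp add: scaleR_sum_right)
  then show ?thesis
    unfolding pow_weight scaleR_sum_right[symmetric] by simp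
qed

text \<open>The steps between successive pairings are known from the diagram, so all pairings follow
  from the first one, and the vanishing of their sum determines that one.\<close>

lemma inner_root_pow_weight:
  assumes "j < p"
  shows "\<alpha> \<bullet> (h ^^ j) weight = (if j = 0 then 1 else if j = 1 then -1 else 0)"
proof -
  let ?y = "\<lambda>j. \<alpha> \<bullet> (h ^^ j) weight"
  have step: "?y (Suc j) = ?y j - \<alpha> \<bullet> (h ^^ j) \<alpha>" for j
    using pow_weight_diff[of j] by (metis add_diff_cancel_left' diff_add_cancel inner_diff_right)
  have y: "?y j = ?y 0 - (if j = 0 then 0 else if j = 1 then 2 else 1)" if "j < p" for j
    using that
  proof (induction j)
    case (Suc j)
    then show ?case
      using step[of j] inner_orbit[of j] by (auto simp del: funpow.simps)
  qed simp
  have "(\<Sum>j<p. ?y j) = 0"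
    using sum_pow_weight by (simp flip: inner_sum_right)
  also have "(\<Sum>j<p. ?y j) = real p * ?y 0 - (\<Sum>j<p. if j = 0 then 0 else if j = 1 then 2 else 1)"
    using y by (simp add: sum_subtractf)
  also have "(\<Sum>j<p. if j = 0 then 0 else if j = 1 then 2 else 1) = real p"
  proof -
    have "(\<Sum>j<p. if j = 0 then 0 else if j = 1 then 2 else 1)
      = (\<Sum>j<p. 1 - (if j = 0 then 1 else 0) + (if j = 1 then 1 else 0 :: real))"
      by (intro sum.cong) auto
    also have "\<dots> = real p"
      using p_ge by (simp add: sum.distrib sum_subtractf)
    finally show ?thesis .
  qed
  finally have "?y 0 = 1" using p_ge by (simp add: field_simps)
  then show ?thesis using y[OF assms] by auto
qed

text \<open>The same argument once more: the steps are now the pairings of \<alpha> with the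
  translated weights.\<close>

lemma inner_weight_pow_weight:
  assumes "j < p"
  shows "weight \<bullet> (h ^^ j) weight = (if j = 0 then 1 else 0) - 1 / real p"
proof -
  let ?d = "\<lambda>j. weight \<bullet> (h ^^ j) weight"
  have d: "?d j = ?d 0 - (if j = 0 then 0 else 1)" if "j < p" for j
    using that
  proof (induction j)
    case (Suc j)
    have "h weight \<bullet> (h ^^ Suc j) weight = ?d j"
      using inner_pow_shift[of 1 "Suc j" weight weight] by simp
    then have "?d (Suc j) = ?d j + \<alpha> \<bullet> (h ^^ Suc j) weight"
      using weight_diff by (metis diff_add_cancel inner_add_left add.commute)
    then show ?case
      using Suc inner_root_pow_weight[of "Suc j"] by (auto simp del: funpow.simps)
  qed simp
  have "(\<Sum>j<p. ?d j) = 0"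
    using sum_pow_weight by (simp flip: inner_sum_right)
  also have "(\<Sum>j<p. ?d j) = real p * ?d 0 - (\<Sum>j<p. if j = 0 then 0 else 1)"
    using d by (simp add: sum_subtractf)
  also have "(\<Sum>j<p. if j = 0 then 0 else 1) = real p - 1"
  proof -
    obtain n where "p = Suc n"
      using p_ge by (metis Suc_le_D numeral_3_eq_3)
    then show ?thesis by (simp add: sum.lessThan_Suc_shift del: sum.lessThan_Suc)
  qed
  finally have "?d 0 = 1 - 1 / real p" using p_ge by (simp add: field_simps)
  then show ?thesis using d[OF assms] by auto
qed

lemma weight_gram:
  assumes "a < p" "b < p"
  shows "(h ^^ a) weight \<bullet> (h ^^ b) weight = (if a = b then 1 else 0) - 1 / real p"
proof -
  have *: "(h ^^ a) weight \<bullet> (h ^^ b) weight = (if a = b then 1 else 0) - 1 / real p"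
    if "a \<le> b" "b < p" for a b
    using inner_pow_shift[OF that(1)] inner_weight_pow_weight[of "b - a"] that by simp
  show ?thesis
    using *[of a b] *[of b a] assms by (cases "a \<le> b") (auto simp: inner_commute)
qed

end

section \<open>Roots of \<open>N\<close> under a fixed-point free isometry of prime order\<close>

locale prime_order_isometry =
  fixes p :: nat and g :: "'a::euclidean_space \<Rightarrow> 'a" and L N :: "'a set"
  assumes prime_p: "prime p" and odd_p: "odd p"
    and orth_g: "orthogonal_transformation g" and order_g: "g ^^ p = id"
    and zero_N: "0 \<in> N" and diff_N: "\<And>x y. x \<in> N \<Longrightarrow> y \<in> N \<Longrightarrow> x - y \<in> N"
    and integral_N: "\<And>x y. x \<in> N \<Longrightarrow> y \<in> N \<Longrightarrow> x \<bullet> y \<in> \<int>"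
    and L_subset: "L \<subseteq> N" and zero_L: "0 \<in> L" and diff_L: "\<And>x y. x \<in> L \<Longrightarrow> y \<in> L \<Longrightarrow> x - y \<in> L"
    and no_roots_L: "\<And>x. x \<in> L \<Longrightarrow> x \<bullet> x \<noteq> 2"
    and g_diff: "\<And>x. x \<in> N \<Longrightarrow> g x - x \<in> L"
    and fixed_point_free: "\<And>x. x \<in> N \<Longrightarrow> g x = x \<Longrightarrow> x = 0"
begin

lemma p_ge_3: "3 \<le> p"
  using prime_p odd_p prime_ge_2_nat[of p] by (cases "p = 2") auto

lemma add_L: "x \<in> L \<Longrightarrow> y \<in> L \<Longrightarrow> x + y \<in> L"
  using diff_L[of x "0 - y"] diff_L[OF zero_L, of y] by simp

lemma add_N: "x \<in> N \<Longrightarrow> y \<in> N \<Longrightarrow> x + y \<in> N"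
  using diff_N[of x "0 - y"] diff_N[OF zero_N, of y] by simp

lemma sum_N: "(\<And>i. i \<in> A \<Longrightarrow> f i \<in> N) \<Longrightarrow> sum f A \<in> N"
  by (induction A rule: infinite_finite_induct) (auto intro: zero_N add_N)

lemma pow_N_and_diff_L:
  assumes "x \<in> N"
  shows "(g ^^ n) x \<in> N \<and> (g ^^ n) x - x \<in> L"
proof (induction n)
  case (Suc n)
  let ?y = "(g ^^ n) x"
  have "g ?y = ?y + (g ?y - ?y)" by simp
  moreover have "g ?y - ?y \<in> L" using Suc g_diff by blast
  ultimately have "g ?y \<in> N" using add_N[of ?y "g ?y - ?y"] Suc L_subset by auto
  moreover have "g ?y - x = (g ?y - ?y) + (?y - x)" by simp
  then have "g ?y - x \<in> L" using add_L[OF \<open>g ?y - ?y \<in> L\<close>, of "?y - x"] Suc by simp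
  ultimately show ?case by simp
qed (use assms zero_L in simp)

lemmas pow_N = pow_N_and_diff_L[THEN conjunct1]
lemmas pow_diff_L = pow_N_and_diff_L[THEN conjunct2]

lemma linear_pow_g: "linear (g ^^ n)"
  using orthogonal_transformation_funpow[OF orth_g] orthogonal_transformation_linear by blast

lemma inner_pow_g: "(g ^^ n) x \<bullet> (g ^^ n) y = x \<bullet> y"
  using orthogonal_transformation_funpow[OF orth_g] by (simp add: orthogonal_transformation_def)

text \<open>If p does not divide n, then n is invertible modulo p and \<open>g\<close> is a power of
  \<open>g ^^ n\<close>; so a vector fixed by the latter would be fixed by \<open>g\<close>.\<close>

lemma pow_eq_self_iff_dvd:
  assumes x: "x \<in> N" "x \<noteq> 0"
  shows "(g ^^ n) x = x \<longleftrightarrow> p dvd n"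
proof
  assume eq: "(g ^^ n) x = x"
  show "p dvd n"
  proof (rule ccontr)
    assume "\<not> p dvd n"
    then have "coprime n p" using prime_imp_coprime[OF prime_p] by (simp add: coprime_commute)
    moreover have "n \<noteq> 0" using \<open>\<not> p dvd n\<close> by (metis dvd_0_right)
    ultimately obtain a b where ab: "n * a = p * b + 1"
      using bezout_nat[of n p] by (auto simp: coprime_iff_gcd_eq_1)
    have fix_pow: "(f ^^ k) x = x" if "f x = x" for f :: "'a \<Rightarrow> 'a" and k
      using that by (induction k) auto
    have "(g ^^ (n * a)) x = x"
      using fix_pow[of "g ^^ n", OF eq] by (simp add: funpow_mult)
    moreover have "(g ^^ (n * a)) x = g x"
      unfolding ab using order_g by (simp add: funpow_mult[symmetric])
    ultimately show False using fixed_point_free[OF x(1)] x(2) by simp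
  qed
next
  assume "p dvd n"
  then show "(g ^^ n) x = x"
    using order_g by (auto simp: funpow_mult[symmetric] elim!: dvdE)
qed

text \<open>The sum is fixed by \<open>g ^^ k\<close>, which has no nonzero fixed vector in
  \<open>N\<close>.\<close>

lemma orbit_sum_0:
  assumes x: "x \<in> N" and k: "\<not> p dvd k"
  shows "(\<Sum>j<p. ((g ^^ k) ^^ j) x) = 0"
proof (rule ccontr)
  let ?h = "g ^^ k"
  let ?s = "\<Sum>j<p. (?h ^^ j) x"
  assume "?s \<noteq> 0"
  moreover have "?s \<in> N" using pow_N[OF x] by (intro sum_N) (simp add: funpow_mult)
  moreover have "?h ?s = ?s"
  proof -
    have "?h ?s = (\<Sum>j<p. (?h ^^ Suc j) x)"
      using linear_sum[OF linear_pow_g] by simp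
    also have "\<dots> = ?s + (?h ^^ p) x - (?h ^^ 0) x"
      by (rule sum_lessThan_shift)
    also have "(?h ^^ p) x = x"
      using order_g by (simp add: funpow_mult mult.commute[of k]) (simp add: funpow_mult[symmetric])
    finally show ?thesis by simp
  qed
  ultimately show False using pow_eq_self_iff_dvd[of ?s k] k by simp
qed

text \<open>A positive integral inner product of distinct roots is 1, but then \<open>x - y\<close>
  is a root in \<open>L\<close>.\<close>

lemma root_inner_le_0:
  assumes x: "x \<in> N" "x \<bullet> x = 2" and y: "y \<in> N" "y \<bullet> y = 2" and xy: "x - y \<in> L" "x \<noteq> y"
  shows "x \<bullet> y \<le> 0"
proof (rule ccontr)
  assume pos: "\<not> x \<bullet> y \<le> 0"
  obtain k where k: "x \<bullet> y = real_of_int k" using integral_N[OF x(1) y(1)] by (auto elim: Ints_cases)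
  have norm: "(x - y) \<bullet> (x - y) = 4 - 2 * (x \<bullet> y)"
    using x y by (simp add: inner_diff_left inner_diff_right inner_commute)
  have "(x - y) \<bullet> (x - y) > 0" using xy by simp
  then have "k = 1" using norm k pos by linarith
  then show False using norm k no_roots_L[OF xy(1)] by simp
qed

text \<open>The inner products along the orbit sum to 0 and start with 2, so a later one is
  negative. The value -2 would mean \<open>(g ^^ k) x = - x\<close>, so that
  \<open>g ^^ (2 * k)\<close> fixes \<open>x\<close>, contrary to p being odd.\<close>

lemma ex_affine_cycle:
  assumes x: "x \<in> N" "x \<bullet> x = 2"
  shows "\<exists>k. 0 < k \<and> k < p \<and> x \<bullet> (g ^^ k) x = -1"
proof -
  have x0: "x \<noteq> 0" using x(2) by auto
  have nonpos: "x \<bullet> (g ^^ j) x \<le> 0" if "0 < j" "j < p" for j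
  proof (rule root_inner_le_0[OF x pow_N[OF x(1)]])
    show "(g ^^ j) x \<bullet> (g ^^ j) x = 2" using x by (simp add: inner_pow_g)
    have "0 - ((g ^^ j) x - x) \<in> L" using diff_L[OF zero_L pow_diff_L[OF x(1)]] .
    then show "x - (g ^^ j) x \<in> L" by simp
    show "x \<noteq> (g ^^ j) x"
      using pow_eq_self_iff_dvd[OF x(1) x0, of j] that by (auto dest: nat_dvd_not_less)
  qed
  have "\<exists>k. 0 < k \<and> k < p \<and> x \<bullet> (g ^^ k) x \<noteq> 0"
  proof (rule ccontr)
    assume none: "\<not> ?thesis"
    have "\<not> p dvd 1" using p_ge_3 by simp
    then have "0 = (\<Sum>j<p. x \<bullet> (g ^^ j) x)"
      using orbit_sum_0[OF x(1), of 1] by (simp flip: inner_sum_right)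
    also have "\<dots> = (\<Sum>j<p. if j = 0 then 2 else 0)"
      using none x by (intro sum.cong) auto
    finally show False using p_ge_3 by simp
  qed
  then obtain k where k: "0 < k" "k < p" "x \<bullet> (g ^^ k) x \<noteq> 0" by blast
  obtain n where n: "x \<bullet> (g ^^ k) x = real_of_int n"
    using integral_N[OF x(1) pow_N[OF x(1)]] by (auto elim: Ints_cases)
  have norm: "(x + (g ^^ k) x) \<bullet> (x + (g ^^ k) x) = 4 + 2 * real_of_int n"
    using x n inner_pow_g[of k x x] by (simp add: inner_add_left inner_add_right inner_commute)
  have "n \<noteq> -2"
  proof
    assume "n = -2"
    then have "x + (g ^^ k) x = 0" using norm by simp
    then have neg: "(g ^^ k) x = - x" by (simp add: eq_neg_iff_add_eq_0 add.commute)
    have "(g ^^ (k + k)) x = (g ^^ k) (- x)" by (simp add: funpow_add neg)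
    also have "\<dots> = x" using linear_neg[OF linear_pow_g, of k x] neg by simp
    finally have "p dvd 2 * k" using pow_eq_self_iff_dvd[OF x(1) x0] by (simp add: mult_2)
    then have "p dvd 2 \<or> p dvd k" using prime_p by (simp add: prime_dvd_mult_iff)
    then show False using p_ge_3 k by (auto dest: nat_dvd_not_less dvd_imp_le)
  qed
  moreover have "-2 \<le> n" using norm inner_ge_zero[of "x + (g ^^ k) x"] by linarith
  moreover have "n < 0" using nonpos[OF k(1,2)] k(3) n by auto
  ultimately have "n = -1" by simp
  then show ?thesis using k n by auto
qed

text \<open>Passing from \<open>g\<close> to this power keeps the orbit and its coset of
  \<open>L\<close>, but makes consecutive roots neighbours in the affine diagram.\<close>

lemma affine_cycle_pow:
  assumes x: "x \<in> N" "x \<bullet> x = 2" and k: "0 < k" "k < p" "x \<bullet> (g ^^ k) x = -1"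
  shows "affine_cycle p (g ^^ k) x"
proof
  have ndvd: "\<not> p dvd k" using k by (auto dest: nat_dvd_not_less)
  have x0: "x \<noteq> 0" using x(2) by auto
  show "3 \<le> p" by (rule p_ge_3)
  show "orthogonal_transformation (g ^^ k)" by (rule orthogonal_transformation_funpow[OF orth_g])
  show "(g ^^ k) ^^ p = id"
    using order_g by (simp add: funpow_mult mult.commute[of k]) (simp add: funpow_mult[symmetric])
  show "(\<Sum>j<p. ((g ^^ k) ^^ j) x) = 0" by (rule orbit_sum_0[OF x(1) ndvd])
  show "x \<bullet> ((g ^^ k) ^^ j) x \<le> 0" if "0 < j" "j < p" for j
    unfolding funpow_mult
  proof (rule root_inner_le_0[OF x pow_N[OF x(1)]])
    show "(g ^^ (k * j)) x \<bullet> (g ^^ (k * j)) x = 2" using x by (simp add: inner_pow_g)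
    have "0 - ((g ^^ (k * j)) x - x) \<in> L" using diff_L[OF zero_L pow_diff_L[OF x(1)]] .
    then show "x - (g ^^ (k * j)) x \<in> L" by simp
    have "\<not> p dvd j" using that by (auto dest: nat_dvd_not_less)
    then have "\<not> p dvd k * j" using ndvd prime_p by (simp add: prime_dvd_mult_iff)
    then show "x \<noteq> (g ^^ (k * j)) x"
      using pow_eq_self_iff_dvd[OF x(1) x0] by metis
  qed
qed (use x k in auto)

section \<open>Orbits of the roots in one coset of \<open>L\<close>\<close>

definition orbit :: "'a \<Rightarrow> 'a set" where
  "orbit x = range (\<lambda>n. (g ^^ n) x)"

lemma orbit_eq_image: "orbit x = (\<lambda>n. (g ^^ n) x) ` {..<p}"
proof (intro equalityI subsetI)
  fix y assume "y \<in> orbit x"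
  then obtain n where "y = (g ^^ n) x" by (auto simp: orbit_def)
  then have "y = (g ^^ (n mod p)) x" using funpow_eq_id_mod[OF order_g, of n] by simp
  then show "y \<in> (\<lambda>n. (g ^^ n) x) ` {..<p}" using p_ge_3 by auto
qed (auto simp: orbit_def)

lemma pow_in_orbit: "(g ^^ n) x \<in> orbit x"
  unfolding orbit_def by (rule range_eqI[of _ _ n]) simp

lemma self_in_orbit: "x \<in> orbit x"
  using pow_in_orbit[of 0 x] by simp

lemma orbit_eqI:
  assumes "y \<in> orbit x"
  shows "orbit y = orbit x"
proof -
  obtain n where n: "n < p" "y = (g ^^ n) x" using assms by (auto simp: orbit_eq_image)
  have "x = (g ^^ (p - n)) y"
    using n order_g by (simp flip: funpow_add[THEN fun_cong, unfolded o_apply])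
  moreover have "orbit ((g ^^ m) z) \<subseteq> orbit z" for m z
    by (auto simp: orbit_def simp flip: funpow_add[THEN fun_cong, unfolded o_apply])
  ultimately show ?thesis using n(2) by (metis subset_antisym)
qed

lemma card_orbit:
  assumes "x \<in> N" "x \<noteq> 0"
  shows "card (orbit x) = p"
proof -
  have "inj_on (\<lambda>n. (g ^^ n) x) {..<p}"
  proof (rule linorder_inj_onI)
    fix a b assume ab: "a < b" "a \<in> {..<p}" "b \<in> {..<p}"
    show "(g ^^ a) x \<noteq> (g ^^ b) x"
    proof
      assume eq: "(g ^^ a) x = (g ^^ b) x"
      have "(g ^^ b) x = (g ^^ (b - a)) ((g ^^ a) x)"
        using ab by (simp flip: funpow_add[THEN fun_cong, unfolded o_apply])
      then have "(g ^^ (b - a)) ((g ^^ a) x) = (g ^^ a) x" using eq by simp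
      moreover have "(g ^^ a) x \<noteq> 0"
        using inner_pow_g[of a x x] assms by (metis inner_eq_zero_iff)
      ultimately have "p dvd b - a"
        using pow_eq_self_iff_dvd[OF pow_N[OF assms(1)]] by blast
      moreover have "0 < b - a" "b - a < p" using ab by auto
      ultimately show False using nat_dvd_not_less by blast
    qed
  qed auto
  then show ?thesis by (simp add: orbit_eq_image card_image)
qed

definition coset_roots :: "'a \<Rightarrow> 'a set" where
  "coset_roots \<nu> = {x \<in> N. x \<bullet> x = 2 \<and> x - \<nu> \<in> L}"

lemma coset_roots_diff:
  assumes "x \<in> coset_roots \<nu>" "y \<in> coset_roots \<nu>"
  shows "x - y \<in> L"
  using assms diff_L[of "x - \<nu>" "y - \<nu>"] by (auto simp: coset_roots_def)

lemma pow_coset_roots: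
  assumes "x \<in> coset_roots \<nu>"
  shows "(g ^^ n) x \<in> coset_roots \<nu>"
proof -
  have x: "x \<in> N" "x \<bullet> x = 2" "x - \<nu> \<in> L" using assms by (auto simp: coset_roots_def)
  have "(g ^^ n) x - \<nu> = ((g ^^ n) x - x) + (x - \<nu>)" by simp
  then have "(g ^^ n) x - \<nu> \<in> L" using add_L[OF pow_diff_L[OF x(1)] x(3)] by metis
  then show ?thesis using x pow_N[OF x(1)] by (simp add: coset_roots_def inner_pow_g)
qed

lemma orbit_subset_coset_roots: "x \<in> coset_roots \<nu> \<Longrightarrow> orbit x \<subseteq> coset_roots \<nu>"
  using pow_coset_roots by (auto simp: orbit_def)

text \<open>All the inner products involved are nonpositive, and they sum to zero over an orbit.\<close>

lemma distinct_orbits_orthogonal: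
  assumes x: "x \<in> coset_roots \<nu>" and y: "y \<in> coset_roots \<nu>" and xy: "orbit x \<noteq> orbit y"
  shows "(g ^^ a) x \<bullet> (g ^^ b) y = 0"
proof -
  let ?x = "(g ^^ a) x"
  have x': "?x \<in> coset_roots \<nu>" by (rule pow_coset_roots[OF x])
  have nonpos: "?x \<bullet> (g ^^ j) y \<le> 0" for j
  proof (rule root_inner_le_0)
    have y': "(g ^^ j) y \<in> coset_roots \<nu>" by (rule pow_coset_roots[OF y])
    show "?x - (g ^^ j) y \<in> L" by (rule coset_roots_diff[OF x' y'])
    show "?x \<noteq> (g ^^ j) y"
    proof
      assume eq: "?x = (g ^^ j) y"
      have "?x \<in> orbit x" "?x \<in> orbit y" using pow_in_orbit[of a x] pow_in_orbit[of j y] eq by simp_all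
      then show False using orbit_eqI xy by metis
    qed
    show "?x \<in> N" "?x \<bullet> ?x = 2" "(g ^^ j) y \<in> N" "(g ^^ j) y \<bullet> (g ^^ j) y = 2"
      using x' y' by (auto simp: coset_roots_def)
  qed
  have "\<not> p dvd 1" using p_ge_3 by simp
  moreover have "y \<in> N" using y by (simp add: coset_roots_def)
  ultimately have "(\<Sum>j<p. ?x \<bullet> (g ^^ j) y) = 0"
    using orbit_sum_0[of y 1] by (simp flip: inner_sum_right)
  then have "(\<Sum>j<p. - (?x \<bullet> (g ^^ j) y)) = 0" by (simp add: sum_negf)
  then have "\<forall>j\<in>{..<p}. - (?x \<bullet> (g ^^ j) y) = 0"
    using nonpos by (subst (asm) sum_nonneg_eq_0_iff) auto
  moreover have "b mod p < p" using p_ge_3 by simp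
  ultimately have "?x \<bullet> (g ^^ (b mod p)) y = 0" by auto
  then show ?thesis using funpow_eq_id_mod[OF order_g, of b] by simp
qed

text \<open>The indices of the frame are the orbits themselves; each comes with a chosen root \<open>a X\<close> and
  an exponent \<open>k X\<close> that orders the orbit cyclically along its affine diagram.\<close>

lemma cyclic_frame_of_choice:
  assumes fin: "finite (coset_roots \<nu>)"
    and a: "\<And>X. X \<in> orbit ` coset_roots \<nu> \<Longrightarrow> a X \<in> X"
    and k: "\<And>X. X \<in> orbit ` coset_roots \<nu> \<Longrightarrow> affine_cycle p (g ^^ k X) (a X)"
  shows "cyclic_frame p (orbit ` coset_roots \<nu>)
    (\<lambda>X j. ((g ^^ k X) ^^ j) (affine_cycle.weight p (g ^^ k X) (a X)))"
proof
  show "0 < p" using p_ge_3 by simp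
  show "finite (orbit ` coset_roots \<nu>)" using fin by simp
next
  fix X X' j l
  assume X: "X \<in> orbit ` coset_roots \<nu>" "X' \<in> orbit ` coset_roots \<nu>" and jl: "j < p" "l < p"
  interpret A: affine_cycle p "g ^^ k X" "a X" by (rule k[OF X(1)])
  interpret B: affine_cycle p "g ^^ k X'" "a X'" by (rule k[OF X(2)])
  show "((g ^^ k X) ^^ j) A.weight \<bullet> ((g ^^ k X') ^^ l) B.weight =
      (if X = X' then (if j = l then 1 else 0) - 1 / real p else 0)"
  proof (cases "X = X'")
    case True
    then show ?thesis using A.weight_gram[OF jl] by simp
  next
    case False
    have mem: "a X \<in> coset_roots \<nu>" "orbit (a X) = X" if "X \<in> orbit ` coset_roots \<nu>" for X
    proof -
      from that obtain x where x: "x \<in> coset_roots \<nu>" "X = orbit x" by auto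
      then show "a X \<in> coset_roots \<nu>" "orbit (a X) = X"
        using a[OF that] orbit_eqI orbit_subset_coset_roots[OF x(1)] by auto
    qed
    have "(g ^^ m) (a X) \<bullet> (g ^^ n) (a X') = 0" for m n
      using mem[OF X(1)] mem[OF X(2)] False by (intro distinct_orbits_orthogonal) auto
    \<comment> \<open>Each weight is a combination of the roots in its own orbit.\<close>
    then show ?thesis
      unfolding A.pow_weight B.pow_weight
      using False by (simp add: funpow_mult inner_sum_left inner_sum_right)
  qed
qed

lemma card_coset_roots:
  assumes "finite (coset_roots \<nu>)"
  shows "card (coset_roots \<nu>) = p * card (orbit ` coset_roots \<nu>)"
proof -
  let ?S = "coset_roots \<nu>"
  have U: "\<Union> (orbit ` ?S) = ?S"
    using orbit_subset_coset_roots self_in_orbit by blast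
  have "p * card (orbit ` ?S) = card (\<Union> (orbit ` ?S))"
  proof (rule card_partition)
    show "finite (orbit ` ?S)" "finite (\<Union> (orbit ` ?S))" using assms U by simp_all
    show "card X = p" if "X \<in> orbit ` ?S" for X
    proof -
      from that obtain x where x: "x \<in> coset_roots \<nu>" "X = orbit x" by auto
      then have "x \<in> N" "x \<noteq> 0" by (auto simp: coset_roots_def)
      then show ?thesis using x card_orbit by simp
    qed
    show "X \<inter> X' = {}" if "X \<in> orbit ` ?S" "X' \<in> orbit ` ?S" "X \<noteq> X'" for X X'
      using that orbit_eqI by blast
  qed
  then show ?thesis using U by simp
qed

text \<open>A cyclic ordering of every orbit turns the orbits into the components of a frame, whose
  simple roots are independent.\<close>

lemma card_coset_roots_le:
  assumes fin: "finite (coset_roots \<nu>)"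
  shows "card (orbit ` coset_roots \<nu>) * (p - 1) \<le> DIM('a)"
proof -
  have "\<exists>x k. x \<in> X \<and> affine_cycle p (g ^^ k) x" if "X \<in> orbit ` coset_roots \<nu>" for X
  proof -
    from that obtain x where x: "x \<in> coset_roots \<nu>" "X = orbit x" by auto
    then have "x \<in> N" "x \<bullet> x = 2" by (auto simp: coset_roots_def)
    from ex_affine_cycle[OF this] affine_cycle_pow[OF this] x(2) self_in_orbit[of x]
    show ?thesis by blast
  qed
  then obtain a k where
    "\<And>X. X \<in> orbit ` coset_roots \<nu> \<Longrightarrow> a X \<in> X"
    "\<And>X. X \<in> orbit ` coset_roots \<nu> \<Longrightarrow> affine_cycle p (g ^^ k X) (a X)"
    by metis
  from cyclic_frame_of_choice[OF fin this] show ?thesis by (rule cyclic_frame.card_components_le)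
qed

text \<open>Moving along the cycle changes the pairing with \<open>c\<close> by \<open>1/p\<close> modulo the integers, so every
  admissible residue occurs.\<close>

lemma ex_adapted_root:
  fixes c :: 'a
  assumes cyc: "affine_cycle p (g ^^ k) x" and c: "\<And>n. c \<bullet> (g ^^ n) x - 1 / real p \<in> \<int>"
  shows "\<exists>j. c \<bullet> ((g ^^ k) ^^ j) (affine_cycle.weight p (g ^^ k) x)
    - (real p - 1) / (2 * real p) \<in> \<int>"
proof -
  interpret affine_cycle p "g ^^ k" x by (rule cyc)
  let ?y = "\<lambda>j. c \<bullet> ((g ^^ k) ^^ j) weight"
  have p0: "0 < real p" using p_ge by simp
  have y: "?y 0 - ?y j - real j / real p \<in> \<int>" for j
  proof (induction j)
    case (Suc j)
    have "?y j - ?y (Suc j) - 1 / real p \<in> \<int>"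
      using c[of "k * j"] pow_weight_diff[of j] by (simp add: funpow_mult flip: inner_diff_right)
    from Ints_add[OF Suc this] show ?case by (simp add: algebra_simps add_divide_distrib)
  qed simp
  obtain q where q: "p = 2 * q + 1" using odd_p by (elim oddE)
  \<comment> \<open>The weights sum to 0, so summing over the cycle leaves
    \<open>p * ?y 0 - q\<close>, where \<open>q = (p - 1) / 2\<close> is an integer because p is
    odd.\<close>
  have "(\<Sum>j<p. ?y 0 - ?y j - real j / real p) \<in> \<int>" using y by (intro Ints_sum)
  moreover have "(\<Sum>j<p. ?y j) = 0" using sum_pow_weight by (simp flip: inner_sum_right)
  moreover have "(\<Sum>j<p. real j / real p) = real q"
  proof -
    have "(\<Sum>j<n. real j) = real n * (real n - 1) / 2" for n
      by (induction n) (auto simp: field_simps)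
    from this[of p] have "(\<Sum>j<p. real j / real p) = real p * (real p - 1) / 2 / real p"
      by (simp flip: sum_divide_distrib)
    also have "\<dots> = (real p - 1) / 2" using p0 by simp
    finally show ?thesis using q by simp
  qed
  ultimately have "real p * ?y 0 - real q \<in> \<int>" by (simp add: sum_subtractf)
  then have "real p * ?y 0 - real q + real q \<in> \<int>" by (intro Ints_add) auto
  then obtain n where n: "real p * ?y 0 = real_of_int n" by (auto elim: Ints_cases)
  \<comment> \<open>Modulo the integers \<open>?y j\<close> is \<open>(n - j) / p\<close>; taking
    \<open>j\<close> congruent to \<open>n - q\<close> gives \<open>q / p\<close>, the first
    coordinate of \<chi> in a component.\<close>
  define j where "j = nat ((n - int q) mod int p)"
  have "int j = (n - int q) mod int p" using p_ge by (simp add: j_def)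
  then have "n - int q = int p * ((n - int q) div int p) + int j" by simp
  then have "real_of_int n - real q = real p * real_of_int ((n - int q) div int p) + real j"
    by (metis of_int_add of_int_diff of_int_mult of_int_of_nat_eq)
  moreover have "(real p - 1) / (2 * real p) = real q / real p"
  proof -
    have "real p - 1 = 2 * real q" using q by simp
    then show ?thesis by (simp only: mult_divide_mult_cancel_left_if) simp
  qed
  ultimately have "?y 0 - real j / real p - (real p - 1) / (2 * real p) = real_of_int ((n - int q) div int p)"
    using n p0 by (simp add: field_simps)
  then have "?y 0 - real j / real p - (real p - 1) / (2 * real p) \<in> \<int>" by simp
  from Ints_diff[OF this y[of j]] have "?y j - (real p - 1) / (2 * real p) \<in> \<int>" by simp
  then show ?thesis by blast
qed

text \<open>Starting the cycle at another root of the orbit moves the weight by the same power of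
  \<open>g\<close>, so the index just found is realised by a change of the starting root.\<close>

lemma ex_adapted_affine_cycle:
  fixes c :: 'a
  assumes x: "x \<in> N" "x \<bullet> x = 2" and c: "\<And>n. c \<bullet> (g ^^ n) x - 1 / real p \<in> \<int>"
  shows "\<exists>a k. a \<in> orbit x \<and> 0 < k \<and> k < p \<and> affine_cycle p (g ^^ k) a \<and>
    c \<bullet> affine_cycle.weight p (g ^^ k) a - (real p - 1) / (2 * real p) \<in> \<int>"
proof -
  obtain k where k: "0 < k" "k < p" "x \<bullet> (g ^^ k) x = -1" using ex_affine_cycle[OF x] by blast
  interpret A: affine_cycle p "g ^^ k" x by (rule affine_cycle_pow[OF x k])
  obtain j where j: "c \<bullet> ((g ^^ k) ^^ j) A.weight - (real p - 1) / (2 * real p) \<in> \<int>"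
    using ex_adapted_root[OF affine_cycle_pow[OF x k] c] by blast
  let ?a = "((g ^^ k) ^^ j) x"
  have "?a \<bullet> (g ^^ k) ?a = -1"
    using A.inner_pow[of j x "(g ^^ k) x"] k(3) by (simp add: funpow_swap1)
  moreover have "?a \<in> N" "?a \<bullet> ?a = 2"
    using pow_N[OF x(1)] x(2) A.inner_pow by (simp_all add: funpow_mult)
  ultimately have cyc: "affine_cycle p (g ^^ k) ?a"
    using affine_cycle_pow k(1,2) by blast
  have "affine_cycle.weight p (g ^^ k) ?a = ((g ^^ k) ^^ j) A.weight"
    unfolding affine_cycle.weight_def[OF cyc] A.pow_weight
    by (simp add: add.commute[of j] funpow_add)
  moreover have "?a \<in> orbit x" unfolding funpow_mult by (rule pow_in_orbit)
  ultimately show ?thesis using cyc k j by metis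
qed

end

context lattice_frame
begin

text \<open>\<open>h\<close> sends each frame vector to the next one, so moving \<open>h\<close>
  across the invariant form shifts the coordinates by one place; \<open>h ^^ p = id\<close> closes
  the cycle.\<close>

lemma coords_funpow:
  assumes h: "\<And>x y. h x \<bullet> h y = x \<bullet> y" "h ^^ p = id"
    and u: "\<And>j. j < p \<Longrightarrow> u i j = (h ^^ j) w" and i: "i < t"
  shows "coords ((h ^^ n) x) i = (cyc p ^^ n) (coords x i)"
proof (induction n)
  case (Suc n)
  have "coords (h y) i = cyc p (coords y i)" for y
  proof
    fix j
    show "coords (h y) i j = cyc p (coords y i) j"
    proof (cases j)
      case 0
      have "h y \<bullet> w = h y \<bullet> (h ^^ Suc (p - 1)) w" using h(2) p_pos by simp
      also have "\<dots> = y \<bullet> (h ^^ (p - 1)) w" by (simp add: h(1))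
      finally show ?thesis using 0 i u[of 0] u[of "p - 1"] p_pos by (simp add: coords_def cyc_def)
    next
      case (Suc l)
      then show ?thesis using i u[of j] u[of l] h(1) by (simp add: coords_def cyc_def)
    qed
  qed
  then show ?case using Suc by simp
qed simp

end

section \<open>Integer spans, dual vectors and inverses modulo p\<close>

lemma module_int_scale: "Modules.module (\<lambda>(k::int) (x::'a::real_vector). real_of_int k *\<^sub>R x)"
  by unfold_locales (auto simp: algebra_simps scaleR_add_left)

lemma zspan_zero: "0 \<in> zspan S"
  unfolding zspan_def by (rule Modules.module.span_zero[OF module_int_scale])

lemma zspan_diff: "x \<in> zspan S \<Longrightarrow> y \<in> zspan S \<Longrightarrow> x - y \<in> zspan S"
  unfolding zspan_def by (rule Modules.module.span_diff[OF module_int_scale])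

lemma zspan_add: "x \<in> zspan S \<Longrightarrow> y \<in> zspan S \<Longrightarrow> x + y \<in> zspan S"
  unfolding zspan_def by (rule Modules.module.span_add[OF module_int_scale])

lemma zspan_scale: "x \<in> zspan S \<Longrightarrow> real_of_int k *\<^sub>R x \<in> zspan S"
  unfolding zspan_def by (rule Modules.module.span_scale[OF module_int_scale])

lemma zspan_insert: "zspan (insert a S) = {x. \<exists>k::int. x - real_of_int k *\<^sub>R a \<in> zspan S}"
  unfolding zspan_def by (rule Modules.module.span_insert[OF module_int_scale])

lemma zspan_zspan: "zspan (zspan S) = zspan S"
  unfolding zspan_def by (rule Modules.module.span_span[OF module_int_scale])

lemma zspan_minimal:
  assumes "S \<subseteq> T" "0 \<in> T" "\<And>x y. x \<in> T \<Longrightarrow> y \<in> T \<Longrightarrow> x + y \<in> T"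
    "\<And>k x. x \<in> T \<Longrightarrow> real_of_int k *\<^sub>R x \<in> T"
  shows "zspan S \<subseteq> T"
  unfolding zspan_def
  by (rule Modules.module.span_minimal[OF module_int_scale assms(1)])
    (use assms(2-) in \<open>simp add: Modules.module.subspace_def[OF module_int_scale]\<close>)

lemma zspan_base: "x \<in> S \<Longrightarrow> x \<in> zspan S"
  unfolding zspan_def by (rule Modules.module.span_base[OF module_int_scale])

lemma zspan_sum: "(\<And>i. i \<in> A \<Longrightarrow> f i \<in> zspan S) \<Longrightarrow> sum f A \<in> zspan S"
  by (induction A rule: infinite_finite_induct) (auto intro: zspan_zero zspan_add)

lemma lattice_rank_eq_DIM:
  fixes L :: "'a::euclidean_space set"
  assumes "lattice_of_rank m L"
  shows "m = DIM('a)"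
proof -
  obtain B :: "'a set" where B: "independent B" "card B = m" "span B = UNIV"
    using assms by (auto simp: lattice_of_rank_def)
  have "card B = dim (span B)" using B(1) by (simp add: dim_eq_card_independent)
  then show ?thesis using B by simp
qed

lemma even_lattice_integral:
  assumes "even_lattice L" "x \<in> L" "y \<in> L"
  shows "x \<bullet> y \<in> \<int>"
proof -
  obtain m where "lattice_of_rank m L" using assms(1) by (auto simp: even_lattice_def)
  then have "x - y \<in> L" using zspan_diff assms(2,3) by (auto simp: lattice_of_rank_def)
  then obtain a b c :: int where "x \<bullet> x = 2 * real_of_int a" "y \<bullet> y = 2 * real_of_int b"
    "(x - y) \<bullet> (x - y) = 2 * real_of_int c"
    using assms unfolding even_lattice_def by metis
  then have "x \<bullet> y = real_of_int (a + b - c)"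
    by (simp add: inner_diff_left inner_diff_right inner_commute)
  then show ?thesis by simp
qed

text \<open>Some coordinate of \<open>x\<close> in a lattice basis is not an integer, while the
  corresponding coordinate functional is integral on \<open>L\<close>.\<close>

lemma ex_dual_vector_not_Ints:
  assumes L: "lattice_of_rank m L" and x: "x \<notin> L"
  shows "\<exists>c\<in>dual_lattice L. c \<bullet> x \<notin> \<int>"
proof -
  obtain B where B: "independent B" "span B = UNIV" "L = zspan B"
    using L by (auto simp: lattice_of_rank_def)
  have fin: "finite B" using B(1) independent_bound by blast
  have "\<exists>b\<in>B. representation B x b \<notin> \<int>"
  proof (rule ccontr)
    assume "\<not> ?thesis"
    then have int: "representation B x b \<in> \<int>" if "b \<in> B" for b using that by blast
    have "representation B x b *\<^sub>R b \<in> zspan B" if "b \<in> B" for b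
      using int[OF that] zspan_scale[OF zspan_base[OF that]] by (auto elim: Ints_cases)
    then have "(\<Sum>b\<in>B. representation B x b *\<^sub>R b) \<in> zspan B" by (rule zspan_sum)
    moreover have "(\<Sum>b\<in>B. representation B x b *\<^sub>R b) = x"
      using sum_representation_eq[OF B(1) _ fin] B(2) by simp
    ultimately show False using x B(3) by simp
  qed
  then obtain b where b: "b \<in> B" "representation B x b \<notin> \<int>" by blast
  define \<phi> where "\<phi> = (\<lambda>y. representation B y b)"
  have "linear \<phi>"
    unfolding \<phi>_def by (rule linearI) (use B in \<open>simp_all add: representation_add representation_scale\<close>)
  \<comment> \<open>The adjoint yields the vector that represents the functional.\<close>
  define c where "c = adjoint \<phi> 1"
  have c: "c \<bullet> y = representation B y b" for y
    using adjoint_works[OF \<open>linear \<phi>\<close>, of y 1] by (simp add: c_def \<phi>_def inner_commute)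
  have "L \<subseteq> {y. c \<bullet> y \<in> \<int>}"
    unfolding B(3)
  proof (rule zspan_minimal)
    show "B \<subseteq> {y. c \<bullet> y \<in> \<int>}"
      using representation_basis[OF B(1)] by (auto simp: c)
  qed (auto simp: inner_add_right)
  then have "c \<in> dual_lattice L" by (auto simp: dual_lattice_def)
  then show ?thesis using b c by metis
qed

lemma isometry_group_pow: "g [^]\<^bsub>isometry_group L\<^esub> (n::nat) = g ^^ n"
  by (induction n) (simp_all add: nat_pow_def isometry_group_def funpow_swap1 fun_eq_iff)

text \<open>Supplies the exponent that recovers \<open>g\<close> from the power
  \<open>g ^^ k\<close> chosen for an orbit.\<close>

lemma ex_inverse_mod_prime:
  fixes p k :: nat
  assumes "prime p" "0 < k" "k < p"
  shows "\<exists>e. 0 < e \<and> e < p \<and> k * e mod p = 1"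
proof -
  have "coprime k p"
    using assms prime_imp_coprime[OF assms(1), of k] nat_dvd_not_less coprime_commute by blast
  then obtain x where "[k * x = 1] (mod p)" using cong_solve_coprime_nat by auto
  then have "k * (x mod p) mod p = 1"
    using assms by (simp add: cong_def mod_mult_right_eq prime_gt_1_nat)
  moreover have "0 < x mod p" using calculation by (cases "x mod p = 0") auto
  ultimately show ?thesis using assms by (intro exI[of _ "x mod p"]) auto
qed

section \<open>Extensions of a rootless lattice by an element of prime order\<close>

locale prime_extension =
  fixes p :: nat and L N :: "'a::euclidean_space set" and lam :: 'a
  assumes prime_p: "prime p" and even_L: "even_lattice L" and rootless_L: "rootless L"
    and lam_dual: "lam \<in> dual_lattice L" and p_lam: "real p *\<^sub>R lam \<in> L"
    and N_def: "N = zspan (insert lam L)" and has_roots: "vectors_of_norm N 2 \<noteq> {}"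
begin

lemma p_pos: "0 < p"
  using prime_p by (rule prime_gt_0_nat)

lemma ex_zspan_L: "\<exists>B. L = zspan B"
  using even_L by (auto simp: even_lattice_def lattice_of_rank_def)

lemma L_zero: "0 \<in> L" and L_diff: "x \<in> L \<Longrightarrow> y \<in> L \<Longrightarrow> x - y \<in> L"
  and L_add: "x \<in> L \<Longrightarrow> y \<in> L \<Longrightarrow> x + y \<in> L"
  and L_scale: "x \<in> L \<Longrightarrow> real_of_int k *\<^sub>R x \<in> L"
  using ex_zspan_L zspan_zero zspan_diff zspan_add zspan_scale by blast+

lemma N_iff: "x \<in> N \<longleftrightarrow> (\<exists>k::int. x - real_of_int k *\<^sub>R lam \<in> L)"
  using ex_zspan_L by (auto simp: N_def zspan_insert zspan_zspan)

lemma N_E: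
  assumes "x \<in> N"
  obtains l and k :: int where "l \<in> L" "x = l + real_of_int k *\<^sub>R lam"
proof -
  from assms obtain k where "x - real_of_int k *\<^sub>R lam \<in> L" by (auto simp: N_iff)
  then show thesis by (rule that[of _ k]) simp
qed

lemma N_zero: "0 \<in> N" and N_diff: "x \<in> N \<Longrightarrow> y \<in> N \<Longrightarrow> x - y \<in> N"
  unfolding N_def using zspan_zero zspan_diff by blast+

lemma L_subset_N: "L \<subseteq> N"
  unfolding N_def by (auto intro: zspan_base)

lemma lam_inner_Ints: "x \<in> L \<Longrightarrow> lam \<bullet> x \<in> \<int>"
  using lam_dual by (simp add: dual_lattice_def)

lemma multiple_lam:
  assumes "int p dvd k"
  shows "real_of_int k *\<^sub>R lam \<in> L"
proof -
  from assms obtain d where "k = int p * d" by (elim dvdE)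
  then show ?thesis using L_scale[OF p_lam, of d] by (simp add: mult.commute)
qed

lemma no_roots: "x \<in> L \<Longrightarrow> x \<bullet> x \<noteq> 2"
  using rootless_L by (auto simp: rootless_def vectors_of_norm_def)

lemma root_coefficient:
  assumes "l \<in> L" "(l + real_of_int k *\<^sub>R lam) \<bullet> (l + real_of_int k *\<^sub>R lam) = 2"
  shows "\<not> int p dvd k"
  using assms L_add multiple_lam no_roots by blast

text \<open>Otherwise \<open>N\<close> is contained in \<open>L\<close>, which has no roots.\<close>

lemma lam_notin_L: "lam \<notin> L"
proof
  assume lam: "lam \<in> L"
  from has_roots obtain \<alpha> where \<alpha>: "\<alpha> \<in> N" "\<alpha> \<bullet> \<alpha> = 2" by (auto simp: vectors_of_norm_def)
  obtain l k where "l \<in> L" "\<alpha> = l + real_of_int k *\<^sub>R lam" using \<alpha>(1) by (rule N_E)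
  then show False using L_add L_scale[OF lam] no_roots \<alpha>(2) by metis
qed

text \<open>The inclusions \<open>\<lambda> \<in> L\<^sup>*\<close> and \<open>p\<lambda> \<in> L\<close> alone only give \<open>(\<lambda>|\<lambda>) \<in> \<int>/p\<close>; the existence of a root
  outside \<open>L\<close> is what makes \<open>N\<close> integral.\<close>

lemma lam_norm_Ints: "lam \<bullet> lam \<in> \<int>"
proof -
  from has_roots obtain \<alpha> where \<alpha>: "\<alpha> \<in> N" "\<alpha> \<bullet> \<alpha> = 2" by (auto simp: vectors_of_norm_def)
  obtain l k where l: "l \<in> L" "\<alpha> = l + real_of_int k *\<^sub>R lam" using \<alpha>(1) by (rule N_E)
  have ndvd: "\<not> int p dvd k" using root_coefficient[OF l(1)] \<alpha>(2) l(2) by simp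
  obtain n where n: "real p * (lam \<bullet> lam) = real_of_int n"
    using lam_inner_Ints[OF p_lam] by (auto elim: Ints_cases)
  obtain a where a: "l \<bullet> l = real_of_int a"
    using even_lattice_integral[OF even_L l(1) l(1)] by (auto elim: Ints_cases)
  obtain b where b: "lam \<bullet> l = real_of_int b"
    using lam_inner_Ints[OF l(1)] by (auto elim: Ints_cases)
  \<comment> \<open>Multiplied by p, this expansion shows that p divides \<open>k * k * n\<close>;
    as p does not divide \<open>k\<close>, it divides \<open>n\<close>, which is p times the norm of
    \<open>lam\<close>.\<close>
  have "2 = l \<bullet> l + 2 * real_of_int k * (lam \<bullet> l) + real_of_int (k * k) * (lam \<bullet> lam)"
    using \<alpha>(2) unfolding l(2) by (simp add: inner_add_left inner_add_right inner_commute algebra_simps)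
  then have "real p * 2 = real p * (real_of_int a + 2 * real_of_int k * real_of_int b
      + real_of_int (k * k) * (lam \<bullet> lam))"
    unfolding a b by simp
  also have "\<dots> = real p * (real_of_int a + 2 * real_of_int k * real_of_int b) + real_of_int (k * k) * real_of_int n"
    unfolding n[symmetric] by (simp add: algebra_simps)
  finally have "real_of_int (k * k * n) = real_of_int (int p * (2 - a - 2 * k * b))"
    by (simp add: algebra_simps)
  then have "k * k * n = int p * (2 - a - 2 * k * b)" by (simp only: of_int_eq_iff)
  then have "int p dvd k * k * n" by simp
  moreover have "prime (int p)" using prime_p by simp
  ultimately have "int p dvd n" using ndvd by (simp add: prime_dvd_mult_iff)
  then obtain d where "n = int p * d" by (elim dvdE)
  then have "lam \<bullet> lam = real_of_int d" using n p_pos by simp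
  then show ?thesis by simp
qed

lemma N_integral:
  assumes "x \<in> N" "y \<in> N"
  shows "x \<bullet> y \<in> \<int>"
proof -
  obtain a j where a: "a \<in> L" "x = a + real_of_int j *\<^sub>R lam" using assms(1) by (rule N_E)
  obtain b k where b: "b \<in> L" "y = b + real_of_int k *\<^sub>R lam" using assms(2) by (rule N_E)
  have "x \<bullet> y = a \<bullet> b + real_of_int j * (lam \<bullet> b) + real_of_int k * (lam \<bullet> a)
      + real_of_int j * real_of_int k * (lam \<bullet> lam)"
    unfolding a(2) b(2) by (simp add: inner_add_left inner_add_right inner_commute algebra_simps)
  also have "\<dots> \<in> \<int>"
    using even_lattice_integral[OF even_L a(1) b(1)] lam_inner_Ints[OF a(1)] lam_inner_Ints[OF b(1)] lam_norm_Ints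
    by (intro Ints_add Ints_mult) auto
  finally show ?thesis .
qed

lemma root_coset:
  assumes "\<alpha> \<in> vectors_of_norm N 2"
  shows "\<exists>j\<in>{1..<p}. \<alpha> - real j *\<^sub>R lam \<in> L"
proof -
  from assms have \<alpha>: "\<alpha> \<in> N" "\<alpha> \<bullet> \<alpha> = 2" by (auto simp: vectors_of_norm_def)
  obtain l k where l: "l \<in> L" "\<alpha> = l + real_of_int k *\<^sub>R lam" using \<alpha>(1) by (rule N_E)
  define j where "j = nat (k mod int p)"
  have j: "int j = k mod int p" using p_pos by (simp add: j_def)
  have "real_of_int (k - int j) *\<^sub>R lam \<in> L" by (rule multiple_lam) (simp add: j)
  from L_add[OF l(1) this] have "\<alpha> - real j *\<^sub>R lam \<in> L"
    unfolding l(2) by (simp add: scaleR_diff_left add_diff_eq)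
  moreover have "\<not> int p dvd k" using root_coefficient[OF l(1)] \<alpha>(2) l(2) by simp
  then have "j \<noteq> 0" using j by (auto simp: dvd_eq_mod_eq_0)
  moreover have "int j < int p" using j p_pos by simp
  ultimately show ?thesis by (intro bexI[of _ j]) auto
qed

text \<open>A dual vector that is not integral at \<open>lam\<close> has there a value
  \<open>n/p\<close> with n prime to p, and a multiple by an inverse of n modulo p normalises it.
  The result identifies N/L with the integers modulo p.\<close>

lemma ex_coset_functional:
  "\<exists>c\<in>dual_lattice L. c \<bullet> lam - 1 / real p \<in> \<int>"
proof -
  obtain m where "lattice_of_rank m L" using even_L by (auto simp: even_lattice_def)
  then obtain d where d: "d \<in> dual_lattice L" "d \<bullet> lam \<notin> \<int>"
    using ex_dual_vector_not_Ints lam_notin_L by blast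
  have "d \<bullet> (real p *\<^sub>R lam) \<in> \<int>" using d(1) p_lam unfolding dual_lattice_def by blast
  then obtain n where n: "real p * (d \<bullet> lam) = real_of_int n" by (auto elim: Ints_cases)
  have "\<not> int p dvd n"
  proof
    assume "int p dvd n"
    then obtain k where "n = int p * k" by (elim dvdE)
    then have "d \<bullet> lam = real_of_int k" using n p_pos by simp
    then show False using d(2) by simp
  qed
  then have "coprime n (int p)"
    using prime_imp_coprime[of "int p" n] prime_p by (simp add: coprime_commute)
  then obtain s where "[n * s = 1] (mod int p)" using cong_solve_coprime_int by blast
  then have "int p dvd n * s - 1" by (simp add: cong_iff_dvd_diff)
  then obtain k where k: "n * s - 1 = int p * k" by (elim dvdE)
  have "real p * (real_of_int s * (d \<bullet> lam)) = real_of_int (n * s)"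
    using n by (simp add: mult.left_commute mult.commute)
  also have "n * s = 1 + int p * k" using k by simp
  finally have "real_of_int s * (d \<bullet> lam) - 1 / real p = real_of_int k"
    using p_pos by (simp add: field_simps)
  then have "(real_of_int s *\<^sub>R d) \<bullet> lam - 1 / real p \<in> \<int>" by simp
  moreover have "real_of_int s *\<^sub>R d \<in> dual_lattice L"
    using d(1) by (auto simp: dual_lattice_def)
  ultimately show ?thesis by blast
qed

context
  fixes c :: 'a
  assumes c_dual: "c \<in> dual_lattice L" and c_lam: "c \<bullet> lam - 1 / real p \<in> \<int>"
begin

lemma coset_functional_value:
  assumes "x - real_of_int k *\<^sub>R lam \<in> L"
  shows "c \<bullet> x - real_of_int k / real p \<in> \<int>"
proof -
  have "c \<bullet> (x - real_of_int k *\<^sub>R lam) \<in> \<int>" using c_dual assms by (auto simp: dual_lattice_def)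
  moreover have "real_of_int k * (c \<bullet> lam - 1 / real p) \<in> \<int>" using c_lam by (intro Ints_mult) auto
  ultimately have "c \<bullet> (x - real_of_int k *\<^sub>R lam) + real_of_int k * (c \<bullet> lam - 1 / real p) \<in> \<int>"
    by (rule Ints_add)
  then show ?thesis by (simp add: inner_diff_right right_diff_distrib)
qed

text \<open>On the coset of \<open>k\<close> times \<open>lam\<close> the value is
  \<open>k/p\<close> modulo the integers, and p divides \<open>k\<close> whenever this is
  integral.\<close>

lemma coset_functional_Ints_iff:
  assumes "x \<in> N"
  shows "x \<bullet> c \<in> \<int> \<longleftrightarrow> x \<in> L"
proof
  assume "x \<bullet> c \<in> \<int>"
  then have xc: "c \<bullet> x \<in> \<int>" by (simp add: inner_commute)
  from assms obtain k where k: "x - real_of_int k *\<^sub>R lam \<in> L" by (auto simp: N_iff)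
  have "real_of_int k / real p \<in> \<int>" using Ints_diff[OF xc coset_functional_value[OF k]] by simp
  then have "int p dvd k" using mod_eq_0_if_quotient_Ints[OF p_pos] by (simp add: dvd_eq_mod_eq_0)
  from L_add[OF k multiple_lam[OF this]] show "x \<in> L" by simp
next
  assume "x \<in> L"
  then show "x \<bullet> c \<in> \<int>" using c_dual by (simp add: dual_lattice_def inner_commute[of x])
qed

end

text \<open>\<open>g - 1\<close> is linear and maps both \<open>L\<close> and \<open>lam\<close>,
  which generate \<open>N\<close>, into \<open>L\<close>.\<close>

lemma linear_diff_L:
  assumes lin: "linear g" and gL: "g ` L = L" and lam: "g lam - lam \<in> L" and x: "x \<in> N"
  shows "g x - x \<in> L"
proof -
  obtain l k where l: "l \<in> L" "x = l + real_of_int k *\<^sub>R lam" using x by (rule N_E)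
  have "g l \<in> L" using l(1) gL by blast
  then have "(g l - l) + real_of_int k *\<^sub>R (g lam - lam) \<in> L"
    using L_add[OF L_diff[OF _ l(1)] L_scale[OF lam]] by blast
  moreover have "g x - x = (g l - l) + real_of_int k *\<^sub>R (g lam - lam)"
    unfolding l(2) using lin by (simp add: linear_add linear_scale scaleR_diff_right)
  ultimately show ?thesis by simp
qed

text \<open>A fixed vector of \<open>N\<close> becomes a fixed vector of \<open>L\<close> after
  multiplication by p.\<close>

lemma fixed_point_free_extends:
  assumes lin: "linear g" and g: "fixed_point_free_on L g" and x: "x \<in> N" "g x = x"
  shows "x = 0"
proof -
  obtain l k where l: "l \<in> L" "x = l + real_of_int k *\<^sub>R lam" using x(1) by (rule N_E)
  have "real_of_int (int p) *\<^sub>R l + real_of_int (int p * k) *\<^sub>R lam \<in> L"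
    using l(1) by (intro L_add L_scale multiple_lam) simp_all
  then have "real p *\<^sub>R x \<in> L" unfolding l(2) by (simp add: scaleR_add_right)
  moreover have "g (real p *\<^sub>R x) = real p *\<^sub>R x" using lin x(2) by (simp add: linear_scale)
  ultimately have "real p *\<^sub>R x = 0" using g unfolding fixed_point_free_on_def by blast
  then show ?thesis using p_pos by simp
qed

end

theorem theorem4p19:
  fixes L N :: "'a::euclidean_space set" and lam :: 'a and g :: "'a \<Rightarrow> 'a" and m p :: nat
  assumes "even_lattice L" and "lattice_of_rank m L" and "rootless L"
    and "prime p" and "odd p"
    and "lam \<in> dual_lattice L" and "real p *\<^sub>R lam \<in> L"
    and "g \<in> carrier (isometry_group L)" and "group.ord (isometry_group L) g = p"
    and "fixed_point_free_on L g"
    and "N = zspan (insert lam L)"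
    and "card (vectors_of_norm N 2) = p * m"
    and "g ` ((+) lam ` L) = (+) lam ` L"
  shows "\<exists>t C f \<Delta> e. m = t * (p - 1) \<and>
           is_code p t C \<and> self_orthogonal p t C \<and>
           is_isometry_onto p t N (constr_A p t C) f \<and> f ` L = constr_B p t C \<and>
           root_base (vectors_of_norm N 2) \<Delta> \<and> f ` \<Delta> = standard_base p t \<and>
           e \<in> dual_code p t C \<and> hamming_weight t e = t \<and>
           (\<forall>x\<in>N. f (g x) = g_std p t e (f x))"
proof -
  have m: "m = DIM('a)" by (rule lattice_rank_eq_DIM[OF assms(2)])
  have p0: "0 < p" "1 < p" using prime_gt_1_nat[OF assms(4)] by auto
  have fin: "finite (vectors_of_norm N 2)" and ne: "vectors_of_norm N 2 \<noteq> {}"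
    using assms(12) p0 m by (auto intro: card_ge_0_finite)
  interpret E: prime_extension p L N lam
    by unfold_locales (use assms ne in auto)
  have orth: "orthogonal_transformation g" and gL: "g ` L = L"
    using assms(8) by (auto simp: isometry_group_def)
  have lin: "linear g" using orth by (rule orthogonal_transformation_linear)
  have order: "g ^^ p = id"
    using group.pow_ord_eq_1[OF group_isometry_group assms(8)] assms(9)
    unfolding isometry_group_pow by (simp add: isometry_group_def)
  have g_lam: "g lam - lam \<in> L"
  proof -
    have "lam \<in> (+) lam ` L" using E.L_zero by force
    then have "g lam \<in> (+) lam ` L" using assms(13) by blast
    then show ?thesis by auto
  qed
  note g_diff = E.linear_diff_L[OF lin gL g_lam]
  interpret P: prime_order_isometry p g L N
    by (unfold_locales; rule assms(4,5) orth order E.N_zero g_diff E.N_diff E.N_integral E.L_subset_N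
        E.L_zero E.L_diff E.no_roots E.fixed_point_free_extends[OF lin assms(10)]; assumption)

  \<comment> \<open>Counting the roots coset by coset\<close>
  define S where "S = (\<lambda>j::nat. P.coset_roots (real j *\<^sub>R lam))"
  have S_fin: "finite (S j)" for j
    by (rule finite_subset[OF _ fin]) (auto simp: S_def P.coset_roots_def vectors_of_norm_def)
  have roots_cover: "vectors_of_norm N 2 \<subseteq> (\<Union>j\<in>{1..<p}. S j)"
    using E.root_coset by (force simp: S_def P.coset_roots_def vectors_of_norm_def)

  define t where "t = card (P.orbit ` P.coset_roots lam)"
  txt \<open>Every one of the \<open>p - 1\<close> cosets outside \<open>L\<close> has at most \<open>pm/(p-1)\<close> roots, so the total \<open>pm\<close>
    leaves no slack in any of them.\<close>
  have t: "t * (p - 1) = DIM('a)"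
  proof (rule ccontr)
    assume neq: "t * (p - 1) \<noteq> DIM('a)"
    have le: "card (S j) * (p - 1) \<le> p * m" for j
      using P.card_coset_roots[of "real j *\<^sub>R lam"] P.card_coset_roots_le[of "real j *\<^sub>R lam"] S_fin[of j] m
      by (simp add: S_def)
    have "t * (p - 1) < DIM('a)"
      using neq P.card_coset_roots_le[of lam] S_fin[of 1] by (simp add: t_def S_def)
    then have less: "card (S 1) * (p - 1) < p * m"
      using P.card_coset_roots[of lam] S_fin[of 1] m p0 by (simp add: S_def t_def)
    have "p * m \<le> card (\<Union>j\<in>{1..<p}. S j)"
      unfolding assms(12)[symmetric] by (rule card_mono[OF _ roots_cover]) (simp add: S_fin)
    also have "\<dots> \<le> (\<Sum>j\<in>{1..<p}. card (S j))" by (rule card_UN_le) simp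
    finally have "p * m * (p - 1) \<le> (\<Sum>j\<in>{1..<p}. card (S j) * (p - 1))"
      by (simp flip: sum_distrib_right)
    also have "\<dots> < (\<Sum>j\<in>{1..<p}. p * m)"
      by (rule sum_strict_mono_ex1) (use le less p0 in auto)
    finally show False by simp
  qed

  \<comment> \<open>Choice of the starting roots and the frame of the coset of
    \<open>lam\<close>\<close>
  obtain c where c: "c \<in> dual_lattice L" "c \<bullet> lam - 1 / real p \<in> \<int>"
    using E.ex_coset_functional by blast
  let ?Q = "P.orbit ` P.coset_roots lam"
  have c_root: "c \<bullet> x - 1 / real p \<in> \<int>" if "x \<in> P.coset_roots lam" for x
    using E.coset_functional_value[OF c, of x 1] that by (simp add: P.coset_roots_def)
  have "\<exists>a k. a \<in> X \<and> 0 < k \<and> k < p \<and> affine_cycle p (g ^^ k) a \<and>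
    c \<bullet> affine_cycle.weight p (g ^^ k) a - (real p - 1) / (2 * real p) \<in> \<int>" if X: "X \<in> ?Q" for X
  proof -
    obtain x where x: "x \<in> P.coset_roots lam" "X = P.orbit x" using X by auto
    then have "x \<in> N" "x \<bullet> x = 2" by (auto simp: P.coset_roots_def)
    from P.ex_adapted_affine_cycle[OF this c_root[OF P.pow_coset_roots[OF x(1)]]]
    show ?thesis using x(2) by simp
  qed
  then obtain a k where ak: "\<And>X. X \<in> ?Q \<Longrightarrow> a X \<in> X" "\<And>X. X \<in> ?Q \<Longrightarrow> 0 < k X"
    "\<And>X. X \<in> ?Q \<Longrightarrow> k X < p" "\<And>X. X \<in> ?Q \<Longrightarrow> affine_cycle p (g ^^ k X) (a X)"
    "\<And>X. X \<in> ?Q \<Longrightarrow> c \<bullet> affine_cycle.weight p (g ^^ k X) (a X) - (real p - 1) / (2 * real p) \<in> \<int>"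
    by metis
  have S1_fin: "finite (P.coset_roots lam)" using S_fin[of 1] by (simp add: S_def)
  interpret Q: cyclic_frame p ?Q "\<lambda>X j. ((g ^^ k X) ^^ j) (affine_cycle.weight p (g ^^ k X) (a X))"
    by (rule P.cyclic_frame_of_choice[OF S1_fin ak(1,4)])
  \<comment> \<open>Numbering the orbits turns them into the components 0, ..., t - 1 of the
    standard model.\<close>
  obtain q where q: "bij_betw q {..<t} ?Q"
    using ex_bij_betw_nat_finite[of ?Q] S1_fin by (auto simp: t_def atLeast0LessThan)
  define w where "w = (\<lambda>i. affine_cycle.weight p (g ^^ k (q i)) (a (q i)))"
  define u where "u = (\<lambda>i j. ((g ^^ k (q i)) ^^ j) (w i))"
  have qQ: "q i \<in> ?Q" if "i < t" for i using q that by (auto simp: bij_betw_def)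
  have root_mem: "(g ^^ n) (a (q i)) \<in> P.coset_roots lam" if "i < t" for i n
  proof -
    from qQ[OF that] obtain x where x: "x \<in> P.coset_roots lam" "q i = P.orbit x" by auto
    then have "a (q i) \<in> P.coset_roots lam"
      using ak(1)[OF qQ[OF that]] P.orbit_subset_coset_roots[OF x(1)] by auto
    then show ?thesis by (rule P.pow_coset_roots)
  qed
  have u_step: "u i j - u i (Suc j) = (g ^^ (k (q i) * j)) (a (q i))" if "i < t" for i j
    using affine_cycle.pow_weight_diff[OF ak(4)[OF qQ[OF that]], of j]
    by (simp add: u_def w_def funpow_mult)

  interpret F: lattice_frame p t u N
  proof
    fix i l j j' assume il: "i \<in> {..<t}" "l \<in> {..<t}" and j: "j < p" "j' < p"
    have "q i = q l \<longleftrightarrow> i = l" using q il by (auto simp: bij_betw_def inj_on_def)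
    then show "u i j \<bullet> u l j' = (if i = l then (if j = j' then 1 else 0) - 1 / real p else 0)"
      using Q.gram[OF qQ qQ j, of i l] il by (simp add: u_def w_def)
  next
    show "u i j - u i (Suc j) \<in> N" if "i < t" for i j
      using root_mem[OF that] unfolding u_step[OF that] by (simp add: P.coset_roots_def)
  qed (use p0 t E.N_zero E.N_diff E.N_integral in blast)+

  \<comment> \<open>Identification of \<open>L\<close> with Construction B\<close>
  have B_iff: "F.coords x \<in> constr_B p t F.code \<longleftrightarrow> x \<in> L" if "x \<in> N" for x
  proof -
    have "F.coords x \<in> constr_B p t F.code \<longleftrightarrow> x \<bullet> c \<in> \<int>"
    proof (rule F.coords_constr_B[OF _ _ that])
      show "c \<bullet> (u i j - u i (Suc j)) - 1 / real p \<in> \<int>" if "i < t" for i j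
        unfolding u_step[OF that] by (rule c_root[OF root_mem[OF that]])
      show "c \<bullet> u i 0 - (real p - 1) / (2 * real p) \<in> \<int>" if "i < t" for i
        using ak(5)[OF qQ[OF that]] by (simp add: u_def w_def)
    qed
    then show ?thesis using E.coset_functional_Ints_iff[OF c that] by simp
  qed
  have L_image: "F.coords ` L = constr_B p t F.code"
  proof (intro equalityI subsetI)
    fix y assume y: "y \<in> constr_B p t F.code"
    then obtain x where "x \<in> N" "y = F.coords x" using F.coords_image by (auto simp: constr_B_def)
    then show "y \<in> F.coords ` L" using y B_iff by blast
  qed (use B_iff E.L_subset_N in blast)

  \<comment> \<open>On component \<open>i\<close> the power \<open>g ^^ k (q i)\<close> is a single
    shift, so \<open>g\<close> itself is the shift by an inverse of \<open>k (q i)\<close> modulo p.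
    Inverses are nonzero, which gives \<open>e\<close> full weight.\<close>
  have "\<exists>e. 0 < e \<and> e < p \<and> k (q i) * e mod p = 1" if "i < t" for i
    using ex_inverse_mod_prime[OF assms(4) ak(2,3)[OF qQ[OF that]]] .
  then obtain e0 where e0: "\<And>i. i < t \<Longrightarrow> 0 < e0 i \<and> e0 i < p \<and> k (q i) * e0 i mod p = 1"
    by metis
  define e where "e = (\<lambda>i\<in>{..<t}. int (e0 i))"
  have e_carrier: "e \<in> carrier (word_group p t)"
    using e0 p0 by (auto simp: e_def carrier_word_group)
  have e_weight: "hamming_weight t e = t"
  proof -
    have "{i \<in> {..<t}. e i \<noteq> 0} = {..<t}" using e0 by (auto simp: e_def)
    then show ?thesis by (simp add: hamming_weight_def)
  qed
  have g_std: "F.coords (g x) = g_std p t e (F.coords x)" for x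
  proof
    fix i
    show "F.coords (g x) i = g_std p t e (F.coords x) i"
    proof (cases "i < t")
      case True
      interpret A: affine_cycle p "g ^^ k (q i)" "a (q i)" by (rule ak(4)[OF qQ[OF True]])
      have "F.coords (((g ^^ k (q i)) ^^ e0 i) x) i = (cyc p ^^ e0 i) (F.coords x i)"
        by (rule F.coords_funpow[of _ _ "w i", OF _ A.order _ True])
          (use A.inner_pow[of 1] in \<open>auto simp: u_def\<close>)
      moreover have "((g ^^ k (q i)) ^^ e0 i) = g"
        unfolding funpow_mult funpow_eq_id_mod[OF order, of "k (q i) * e0 i"] using e0[OF True] by simp
      ultimately show ?thesis using True by (simp add: g_std_def e_def)
    qed (auto simp: F.coords_def g_std_def)
  qed
  have e_dual: "e \<in> dual_code p t F.code"
  proof (rule F.dual_code_if_shift[OF e_carrier g_std])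
    show "F.coords (g x - x) \<in> constr_B p t F.code" if "x \<in> N" for x
      using B_iff[OF subsetD[OF E.L_subset_N g_diff[OF that]]] g_diff[OF that] by simp
  qed

  have cardN: "card (vectors_of_norm N 2) = p * DIM('a)" using assms(12) m by simp
  show ?thesis
    using F.is_code_code F.self_orthogonal_code F.coords_isometry L_image F.root_base_base[OF cardN]
      F.coords_base e_dual e_weight g_std t m by metis
qed

end
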